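(* Let $(X,d)$ be an unbounded complete separable metric space and let $\mu$ be a Borel measure on $X$ for which there are constants $\alpha>0$ and $C_V>0$ such that $$0<\mu(B_r(x))\le C_V r^{\alpha}\qquad\text{for all } x\in X,\ r\ge 1.$$ Fix $1\le p<\infty$ and $o\in X$. Let $\mathcal E_s$, $\mathcal F_s$, $H_s$, $\mathcal D_{\alpha,p}$, $V_x$ be as defined in the context. Then the following hold. (1) For every $u\in L^p(X,\mu)$, $$\mathcal F_s(u)-2H_s(o)\|u\|_p^p\longrightarrow 0\qquad\text{as } s\downarrow 0.$$ (2) For every $u\in\mathcal D_{\alpha,p}$, $$\mathcal E_s(u)-2H_s(o)\|u\|_p^p\longrightarrow 0\qquad\text{as } s\downarrow 0.$$ (3) Let $h_o(t)=e^{-\alpha t}V_o(e^t)$ for $t\ge 0$ and $M_o(T)=\frac1T\int_0^T h_o(t)\,dt$ for $T>0$. For every function $u\in\mathcal D_{\alpha,p}$ with $\|u\|_p>0$, the following three conditions are equivalent: (a) $\lim_{s\downarrow 0}\mathcal E_s(u)$ exists; (b) $\lim_{s\downarrow 0}H_s(o)$ exists; (c) $\lim_{T\to\infty}M_o(T)=:\mathsf M_\alpha(X)$ exists. Whenever these conditions hold, $$\mathsf M_\alpha(X)=\lim_{R\to\infty}\frac{1}{\log R}\int_1^R\frac{V_o(r)}{r^\alpha}\,\frac{dr}{r}$$ is independent of the choice of the base point $o$, and for every $v\in\mathcal D_{\alpha,p}$, $$\lim_{s\downarrow 0}\mathcal E_s(v)=\frac{2\alpha}{p}\,\mathsf M_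\alpha(X)\,\|v\|_p^p.$$
   Context: Balls are closed: $B_r(x)=\{y\in X: d(x,y)\le r\}$, and $V_x(r)=\mu(B_r(x))$. The norm of $L^p(X,\mu)$ is $\|u\|_p=\left(\int_X|u|^p\,d\mu\right)^{1/p}$. For $s>0$ define $$[u]_{s,p;\alpha}^p=\iint_{x\ne y}\frac{|u(x)-u(y)|^p}{d(x,y)^{\alpha+sp}}\,d\mu(x)\,d\mu(y),\qquad \mathcal E_s(u)=s\,[u]_{s,p;\alpha}^p,$$ $$\mathcal D_{\alpha,p}=\bigcup_{0<s_0<1}\{u\in L^p(X,\mu): [u]_{s_0,p;\alpha}<\infty\},$$ $$\mathcal F_s(u)=s\iint_{d(x,y)>1}\frac{|u(x)-u(y)|^p}{d(x,y)^{\alpha+sp}}\,d\mu(x)\,d\mu(y),\qquad H_s(x)=s\int_{d(x,y)>1}d(x,y)^{-\alpha-sp}\,d\mu(y).$$ *)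

theory Defs
  imports "HOL-Analysis.Analysis"
begin

text \<open>Balls are closed. The volume is real-valued; the hypothesis of the theorem bounds the
  extended measure of every ball of radius at least one, so all balls have finite measure.\<close>

definition ball_volume :: "'a::metric_space measure \<Rightarrow> 'a \<Rightarrow> real \<Rightarrow> real" where
  "ball_volume \<mu> x r = measure \<mu> (cball x r)"

definition Lp_space :: "'a measure \<Rightarrow> real \<Rightarrow> ('a \<Rightarrow> real) set" where
  "Lp_space \<mu> p = {u \<in> borel_measurable \<mu>. integrable \<mu> (\<lambda>x. \<bar>u x\<bar> powr p)}"

definition Lp_norm :: "'a measure \<Rightarrow> real \<Rightarrow> ('a \<Rightarrow> real) \<Rightarrow> real" where
  "Lp_norm \<mu> p u = (\<integral>x. \<bar>u x\<bar> powr p \<partial>\<mu>) powr (1 / p)"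

definition gagliardo_kernel ::
    "real \<Rightarrow> real \<Rightarrow> real \<Rightarrow> ('a::metric_space \<Rightarrow> real) \<Rightarrow> 'a \<times> 'a \<Rightarrow> ennreal" where
  "gagliardo_kernel \<alpha> p s u =
     (\<lambda>(x, y). ennreal (\<bar>u x - u y\<bar> powr p / dist x y powr (\<alpha> + s * p)))"

text \<open>The \<open>p\<close>-th power of the seminorm, and the functionals below, take values in
  \<open>[0, \<infinity>]\<close>.\<close>

definition gagliardo_pow ::
    "'a::metric_space measure \<Rightarrow> real \<Rightarrow> real \<Rightarrow> real \<Rightarrow> ('a \<Rightarrow> real) \<Rightarrow> ennreal" where
  "gagliardo_pow \<mu> \<alpha> p s u =
     (\<integral>\<^sup>+z\<in>{(x, y). x \<noteq> y}. gagliardo_kernel \<alpha> p s u z \<partial>(\<mu> \<Otimes>\<^sub>M \<mu>))"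

definition energy ::
    "'a::metric_space measure \<Rightarrow> real \<Rightarrow> real \<Rightarrow> real \<Rightarrow> ('a \<Rightarrow> real) \<Rightarrow> ennreal" where
  "energy \<mu> \<alpha> p s u = ennreal s * gagliardo_pow \<mu> \<alpha> p s u"

definition energy_domain ::
    "'a::metric_space measure \<Rightarrow> real \<Rightarrow> real \<Rightarrow> ('a \<Rightarrow> real) set" where
  "energy_domain \<mu> \<alpha> p =
     (\<Union>s0\<in>{0<..<1}. {u \<in> Lp_space \<mu> p. gagliardo_pow \<mu> \<alpha> p s0 u < \<infinity>})"

definition far_energy ::
    "'a::metric_space measure \<Rightarrow> real \<Rightarrow> real \<Rightarrow> real \<Rightarrow> ('a \<Rightarrow> real) \<Rightarrow> ennreal" where
  "far_energy \<mu> \<alpha> p s u =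
     ennreal s * (\<integral>\<^sup>+z\<in>{(x, y). dist x y > 1}. gagliardo_kernel \<alpha> p s u z \<partial>(\<mu> \<Otimes>\<^sub>M \<mu>))"

definition tail_potential ::
    "'a::metric_space measure \<Rightarrow> real \<Rightarrow> real \<Rightarrow> real \<Rightarrow> 'a \<Rightarrow> ennreal" where
  "tail_potential \<mu> \<alpha> p s x =
     ennreal s * (\<integral>\<^sup>+y\<in>{y. dist x y > 1}. ennreal (dist x y powr (- \<alpha> - s * p)) \<partial>\<mu>)"

definition log_density :: "'a::metric_space measure \<Rightarrow> real \<Rightarrow> 'a \<Rightarrow> real \<Rightarrow> real" where
  "log_density \<mu> \<alpha> x t = exp (- \<alpha> * t) * ball_volume \<mu> x (exp t)"

definition mean_density :: "'a::metric_space measure \<Rightarrow> real \<Rightarrow> 'a \<Rightarrow> real \<Rightarrow> real" where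
  "mean_density \<mu> \<alpha> x T = 1 / T * (LBINT t:{0..T}. log_density \<mu> \<alpha> x t)"

end

theory Submission
  imports Defs
begin

text \<open>
  Put \<open>U = \<bar>u\<bar>\<^sup>p\<close> and let \<open>W\<^sub>s(x, y) = s d(x, y)\<^bsup>-\<alpha>-sp\<^esup>\<close> on pairs at distance greater than
  one. The kernel \<open>W\<^sub>s\<close> is at most \<open>s\<close> pointwise, while its mass \<open>H\<^sub>s(x)\<close> in one variable stays
  bounded. As \<open>s \<down> 0\<close> this mass therefore escapes to infinity, where an integrable function
  is negligible: for a typical pair weighted by \<open>W\<^sub>s\<close> one of \<open>u(x)\<close>, \<open>u(y)\<close> is much smaller than
  the other, and \<open>\<bar>u(x) - u(y)\<bar>\<^sup>p\<close> may be replaced by \<open>U(x) + U(y)\<close>. The error is controlled by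
  the mass of \<open>min (U x) (U y)\<close>, and this tends to zero because by Markov's inequality the set
  \<open>{U \<ge> U(x)}\<close> has finite measure when \<open>U(x) > 0\<close>, so that it carries \<open>W\<^sub>s(x, \<cdot>)\<close>-mass
  \<open>O(s)\<close>. This is \<open>symmetric_kernel_energy_decouples\<close>. It reduces the far energy to
  \<open>2 \<integral> U H\<^sub>s\<close>. Two points at distance \<open>D\<close> see distant points at distances that differ by at most
  \<open>D\<close>, whence \<open>H\<^sub>s(x) - H\<^sub>s(o) = O(s)\<close> and \<open>\<integral> U H\<^sub>s\<close> may be replaced by \<open>H\<^sub>s(o) \<integral> U\<close>. The part of
  the energy over pairs at distance at most one is \<open>s\<close> times a quantity that increases with \<open>s\<close> and
  is finite for some \<open>s\<close>, so it disappears in the limit.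

  When \<open>\<parallel>u\<parallel>\<^sub>p > 0\<close>, the existence of the limit is thus a question about \<open>H\<^sub>s(o)\<close>
  alone. A layer cake computation in the variable \<open>t = log r\<close> gives
  \<open>H\<^sub>s(o) = s (\<alpha> + sp) \<integral>\<^sub>0\<^sup>\<infinity> h\<^sub>o(t) e\<^bsup>-spt\<^esup> dt - s V\<^sub>o(1)\<close>,
  so up to the factor \<open>(\<alpha> + sp) / p\<close> and a vanishing term it is the Abel mean
  \<open>\<lambda> \<integral> h\<^sub>o(t) e\<^bsup>-\<lambda>t\<^esup> dt\<close> of the bounded function \<open>h\<^sub>o\<close> at \<open>\<lambda> = sp\<close>. For bounded functions, Abel means
  and Cesaro means converge simultaneously and to the same limit; this is the
  Hardy--Littlewood--Karamata theorem, here \<open>laplace_mean_iff_cesaro_mean\<close>.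
  It yields the equivalence with the convergence of \<open>M\<^sub>o(T)\<close> and the value of the limit.
\<close>

section \<open>Decoupling of the energy of a vanishing kernel\<close>

text \<open>If one of two numbers is much smaller than the other, removing it changes the \<open>p\<close>-th power of the
  larger one only by a small proportion; otherwise everything is comparable to the smaller of the
  two powers. Unlike Minkowski's inequality this also compares the integrand with
  \<open>\<bar>a\<bar>\<^sup>p + \<bar>b\<bar>\<^sup>p\<close>, which is what makes the energy split into two equal halves.\<close>

lemma abs_diff_powr_almost_additive:
  fixes p e :: real
  assumes p: "0 < p" and e: "0 < e"
  obtains K where "0 \<le> K"
    "\<And>a b :: real. \<bar>\<bar>a - b\<bar> powr p - \<bar>a\<bar> powr p - \<bar>b\<bar> powr p\<bar>
       \<le> e * (\<bar>a\<bar> powr p + \<bar>b\<bar> powr p) + K * min (\<bar>a\<bar> powr p) (\<bar>b\<bar> powr p)"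
proof -
  have "((\<lambda>d. (1 + d) powr p) \<longlongrightarrow> (1 + 0) powr p) (at_right 0)"
       "((\<lambda>d. (1 - d) powr p) \<longlongrightarrow> (1 - 0) powr p) (at_right 0)"
    by (intro tendsto_intros; simp)+
  then have "\<forall>\<^sub>F d in at_right 0. (1 + d) powr p < 1 + e"
       "\<forall>\<^sub>F d in at_right 0. (1 - d) powr p > 1 - e"
    using e by (auto intro: order_tendstoD)
  moreover have "\<forall>\<^sub>F d in at_right (0::real). 0 < d \<and> d < 1"
    using eventually_at_right_less[of "0::real"] eventually_at_right_real[of 0 "1::real"] by (auto elim: eventually_mono)
  ultimately have "\<forall>\<^sub>F d in at_right (0::real). (1 + d) powr p < 1 + e \<and> (1 - d) powr p > 1 - e \<and> 0 < d \<and> d < 1"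
    by eventually_elim auto
  then obtain d where d: "(1 + d) powr p < 1 + e" "(1 - d) powr p > 1 - e" "0 < d" "d < 1"
    using eventually_happens' trivial_limit_at_right_real by blast
  \<comment> \<open>if \<open>d \<bar>a\<bar> < \<bar>b\<bar>\<close>, then \<open>(1 / d + 1) \<bar>b\<bar>\<close> dominates both \<open>\<bar>a - b\<bar>\<close> and
    \<open>\<bar>a\<bar>\<close>; the last summand 1 of \<open>K\<close> accounts for \<open>\<bar>b\<bar>\<^sup>p\<close>\<close>
  define K where "K = (1 / d + 1) powr p + 1"
  have larger: "\<bar>\<bar>a - b\<bar> powr p - \<bar>a\<bar> powr p - \<bar>b\<bar> powr p\<bar> \<le> e * \<bar>a\<bar> powr p + K * \<bar>b\<bar> powr p"
    if ab: "\<bar>b\<bar> \<le> \<bar>a\<bar>" for a b :: real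
  proof (cases "\<bar>b\<bar> \<le> d * \<bar>a\<bar>")
    case True
    have "\<bar>a - b\<bar> powr p \<le> ((1 + d) * \<bar>a\<bar>) powr p"
      using True p d by (intro powr_mono2) (auto simp: algebra_simps)
    also have "\<dots> = (1 + d) powr p * \<bar>a\<bar> powr p"
      using d by (simp add: powr_mult)
    also have "\<dots> \<le> (1 + e) * \<bar>a\<bar> powr p"
      using d by (intro mult_right_mono) auto
    finally have up: "\<bar>a - b\<bar> powr p \<le> (1 + e) * \<bar>a\<bar> powr p" .
    have "(1 - e) * \<bar>a\<bar> powr p \<le> (1 - d) powr p * \<bar>a\<bar> powr p"
      using d by (intro mult_right_mono) auto
    also have "\<dots> = ((1 - d) * \<bar>a\<bar>) powr p"
      using d by (simp add: powr_mult)
    also have "\<dots> \<le> \<bar>a - b\<bar> powr p"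
      using True p d mult_right_mono[of d 1 "\<bar>a\<bar>"] by (intro powr_mono2) (auto simp: algebra_simps)
    finally have "\<bar>\<bar>a - b\<bar> powr p - \<bar>a\<bar> powr p\<bar> \<le> e * \<bar>a\<bar> powr p"
      using up by (auto simp: algebra_simps abs_le_iff)
    moreover have "1 * \<bar>b\<bar> powr p \<le> K * \<bar>b\<bar> powr p"
      unfolding K_def by (intro mult_right_mono) auto
    moreover have "\<bar>x - y\<bar> \<le> z \<Longrightarrow> 1 * t \<le> w \<Longrightarrow> 0 \<le> t \<Longrightarrow> \<bar>x - y - t\<bar> \<le> z + w" for x y z t w :: real
      by linarith
    ultimately show ?thesis by simp
  next
    case False
    have small: "\<bar>a\<bar> \<le> 1 / d * \<bar>b\<bar>" using False d by (simp add: field_simps)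
    have "\<bar>a - b\<bar> powr p \<le> ((1 / d + 1) * \<bar>b\<bar>) powr p"
      using small p d by (intro powr_mono2) (auto simp: algebra_simps)
    moreover have "\<bar>a\<bar> powr p \<le> ((1 / d + 1) * \<bar>b\<bar>) powr p"
      using small p d by (intro powr_mono2) (auto simp: algebra_simps)
    moreover have "((1 / d + 1) * \<bar>b\<bar>) powr p = (1 / d + 1) powr p * \<bar>b\<bar> powr p"
      using d by (simp add: powr_mult)
    moreover have "0 \<le> \<bar>a - b\<bar> powr p" "0 \<le> \<bar>a\<bar> powr p" "0 \<le> \<bar>b\<bar> powr p" "0 \<le> e * \<bar>a\<bar> powr p"
      using e by auto
    moreover have "K * \<bar>b\<bar> powr p = (1 / d + 1) powr p * \<bar>b\<bar> powr p + \<bar>b\<bar> powr p"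
      by (simp add: K_def algebra_simps)
    moreover have "x \<le> z \<Longrightarrow> y \<le> z \<Longrightarrow> 0 \<le> x \<Longrightarrow> 0 \<le> y \<Longrightarrow> 0 \<le> t \<Longrightarrow> 0 \<le> w \<Longrightarrow>
        \<bar>x - y - t\<bar> \<le> w + (z + t)" for x y z t w :: real
      by linarith
    ultimately show ?thesis by metis
  qed
  show thesis
  proof (rule that)
    show "0 \<le> K" by (simp add: K_def)
    fix a b :: real
    have mono: "\<bar>x\<bar> \<le> \<bar>y\<bar> \<Longrightarrow> \<bar>x\<bar> powr p \<le> \<bar>y\<bar> powr p" for x y :: real
      using p by (intro powr_mono2) auto
    have nn: "0 \<le> e * \<bar>x\<bar> powr p" for x :: real using e by auto
    show "\<bar>\<bar>a - b\<bar> powr p - \<bar>a\<bar> powr p - \<bar>b\<bar> powr p\<bar>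
       \<le> e * (\<bar>a\<bar> powr p + \<bar>b\<bar> powr p) + K * min (\<bar>a\<bar> powr p) (\<bar>b\<bar> powr p)"
    proof (cases "\<bar>b\<bar> \<le> \<bar>a\<bar>")
      case True
      then show ?thesis
        using larger[OF True] mono[OF True] nn[of b] by (simp add: min_absorb2 algebra_simps)
    next
      case False
      then have "\<bar>a\<bar> \<le> \<bar>b\<bar>" by simp
      then show ?thesis
        using larger[of a b] mono[of a b] nn[of a]
        by (simp add: min_absorb1 algebra_simps abs_minus_commute)
    qed
  qed
qed

lemma dominated_convergence_at_right_0:
  fixes f :: "'a \<Rightarrow> real" and g :: "real \<Rightarrow> 'a \<Rightarrow> real"
  assumes [measurable]: "f \<in> borel_measurable M" "\<And>s. g s \<in> borel_measurable M"
    and w: "integrable M w"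
    and lim: "AE x in M. ((\<lambda>s. g s x) \<longlongrightarrow> f x) (at_right 0)"
    and bound: "\<forall>\<^sub>F s in at_right 0. AE x in M. \<bar>g s x\<bar> \<le> w x"
  shows "((\<lambda>s. \<integral>x. g s x \<partial>M) \<longlongrightarrow> (\<integral>x. f x \<partial>M)) (at_right 0)"
  unfolding filterlim_at_right_to_top
proof (rule integral_dominated_convergence_at_top[OF _ _ w])
  show "AE x in M. ((\<lambda>s. g (inverse s) x) \<longlongrightarrow> f x) at_top"
    using lim unfolding filterlim_at_right_to_top .
  show "\<forall>\<^sub>F s in at_top. AE x in M. norm (g (inverse s) x) \<le> w x"
    using bound unfolding eventually_at_right_to_top by simp
qed auto

text \<open>The hypotheses say that the kernels have bounded mass but become uniformly small, so their mass
  moves to infinity. The error made by decoupling is a small multiple of \<open>\<integral> U W\<^sub>s\<close> plus a constant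
  times the integral of \<open>min (U x) (U y) W\<^sub>s(x, y)\<close>, by \<open>abs_diff_powr_almost_additive\<close>. The
  minimum is at most the sum of \<open>U(x)\<close> where \<open>U(y) \<ge> U(x)\<close> and of \<open>U(y)\<close> where
  \<open>U(x) \<ge> U(y)\<close>, two terms that are exchanged by symmetry.\<close>

lemma
  fixes W :: "real \<Rightarrow> 'a \<Rightarrow> 'a \<Rightarrow> real" and u :: "'a \<Rightarrow> real" and p B :: real
  assumes "sigma_finite_measure M"
    and W[measurable]: "\<And>s. (\<lambda>(x, y). W s x y) \<in> borel_measurable (M \<Otimes>\<^sub>M M)"
    and nonneg: "\<And>s x y. 0 < s \<Longrightarrow> 0 \<le> W s x y"
    and small: "\<And>s x y. 0 < s \<Longrightarrow> W s x y \<le> s"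
    and sym: "\<And>s x y. W s x y = W s y x"
    and B: "\<And>s x. 0 < s \<Longrightarrow> s < 1 \<Longrightarrow> (\<integral>\<^sup>+y. ennreal (W s x y) \<partial>M) \<le> ennreal B" "0 \<le> B"
    and u[measurable]: "u \<in> borel_measurable M" and U: "integrable M (\<lambda>x. \<bar>u x\<bar> powr p)"
    and p: "0 < p"
  shows symmetric_kernel_energy_integrable:
      "\<And>s. 0 < s \<Longrightarrow> s < 1 \<Longrightarrow> integrable (M \<Otimes>\<^sub>M M) (\<lambda>(x, y). \<bar>u x - u y\<bar> powr p * W s x y)"
    and symmetric_kernel_energy_decouples:
      "((\<lambda>s. (\<integral>(x, y). \<bar>u x - u y\<bar> powr p * W s x y \<partial>(M \<Otimes>\<^sub>M M))
          - 2 * (\<integral>x. \<bar>u x\<bar> powr p * (\<integral>y. W s x y \<partial>M) \<partial>M)) \<longlongrightarrow> 0) (at_right 0)"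
proof -
  interpret M: sigma_finite_measure M by fact
  interpret P: pair_sigma_finite M M ..
  have W'[measurable]: "(\<lambda>z. W s (fst z) (snd z)) \<in> borel_measurable (M \<Otimes>\<^sub>M M)" for s
    using W[of s] by (simp add: case_prod_beta)
  define V where "V x = \<bar>u x\<bar> powr p" for x
  have [measurable]: "V \<in> borel_measurable M" unfolding V_def by measurable
  have V: "integrable M V" "\<And>x. 0 \<le> V x" using U by (auto simp: V_def[abs_def])
  define N where "N = (\<integral>x. V x \<partial>M)"
  have N: "0 \<le> N" unfolding N_def using V by simp
  define f1 where "f1 s z = V (fst z) * W s (fst z) (snd z)" for s and z :: "'a \<times> 'a"
  define f2 where "f2 s z = V (snd z) * W s (fst z) (snd z)" for s and z :: "'a \<times> 'a"
  define g1 where "g1 s z = V (fst z) * (indicator {t. 0 \<le> t} (V (snd z) - V (fst z)) * W s (fst z) (snd z))" for s and z :: "'a \<times> 'a"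
  define g2 where "g2 s z = V (snd z) * (indicator {t. 0 \<le> t} (V (fst z) - V (snd z)) * W s (fst z) (snd z))" for s and z :: "'a \<times> 'a"
  define E where "E s z = \<bar>u (fst z) - u (snd z)\<bar> powr p * W s (fst z) (snd z)" for s and z :: "'a \<times> 'a"
  have [measurable]: "f1 s \<in> borel_measurable (M \<Otimes>\<^sub>M M)" "f2 s \<in> borel_measurable (M \<Otimes>\<^sub>M M)"
    "g1 s \<in> borel_measurable (M \<Otimes>\<^sub>M M)" "g2 s \<in> borel_measurable (M \<Otimes>\<^sub>M M)"
    "E s \<in> borel_measurable (M \<Otimes>\<^sub>M M)" for s
    unfolding f1_def[abs_def] f2_def[abs_def] g1_def[abs_def] g2_def[abs_def] E_def[abs_def] by measurable
  have swap: "f2 s = (\<lambda>(x, y). f1 s (y, x))" "g2 s = (\<lambda>(x, y). g1 s (y, x))" for s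
    by (auto simp: f1_def f2_def g1_def g2_def sym[of s] fun_eq_iff)
  have int_f1: "integrable (M \<Otimes>\<^sub>M M) (f1 s)" if s: "0 < s" "s < 1" for s
  proof (rule integrableI_nonneg)
    show "AE z in M \<Otimes>\<^sub>M M. 0 \<le> f1 s z" using V nonneg s by (auto simp: f1_def)
    have "(\<integral>\<^sup>+z. ennreal (f1 s z) \<partial>(M \<Otimes>\<^sub>M M)) = (\<integral>\<^sup>+x. \<integral>\<^sup>+y. ennreal (f1 s (x, y)) \<partial>M \<partial>M)"
      by (rule M.nn_integral_fst[symmetric]) measurable
    also have "\<dots> = (\<integral>\<^sup>+x. ennreal (V x) * (\<integral>\<^sup>+y. ennreal (W s x y) \<partial>M) \<partial>M)"
      using V s nonneg by (intro nn_integral_cong) (simp add: f1_def ennreal_mult nn_integral_cmult)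
    also have "\<dots> \<le> (\<integral>\<^sup>+x. ennreal (V x) * ennreal B \<partial>M)"
      using B s by (intro nn_integral_mono mult_left_mono) auto
    also have "\<dots> = (\<integral>\<^sup>+x. ennreal (V x) \<partial>M) * ennreal B" by (rule nn_integral_multc) measurable
    also have "\<dots> < \<infinity>"
      using V by (simp add: nn_integral_eq_integral ennreal_mult_less_top)
    finally show "(\<integral>\<^sup>+z. ennreal (f1 s z) \<partial>(M \<Otimes>\<^sub>M M)) < \<infinity>" .
  qed measurable
  have int_f2: "integrable (M \<Otimes>\<^sub>M M) (f2 s)" if s: "0 < s" "s < 1" for s
    unfolding swap using int_f1[OF s] by (simp only: P.integrable_product_swap_iff)
  have val_f2: "(\<integral>z. f2 s z \<partial>(M \<Otimes>\<^sub>M M)) = (\<integral>z. f1 s z \<partial>(M \<Otimes>\<^sub>M M))" for s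
    unfolding swap by (rule P.integral_product_swap) measurable
  have val_f1: "(\<integral>z. f1 s z \<partial>(M \<Otimes>\<^sub>M M)) = (\<integral>x. V x * (\<integral>y. W s x y \<partial>M) \<partial>M)" if s: "0 < s" "s < 1" for s
  proof -
    have "(\<integral>z. f1 s z \<partial>(M \<Otimes>\<^sub>M M)) = (\<integral>x. \<integral>y. f1 s (x, y) \<partial>M \<partial>M)"
      using P.integral_fst'[OF int_f1[OF s]] by simp
    also have "\<dots> = (\<integral>x. V x * (\<integral>y. W s x y \<partial>M) \<partial>M)" by (simp add: f1_def)
    finally show ?thesis .
  qed
  have W_mass: "(\<integral>y. W s x y \<partial>M) \<le> B" if "0 < s" "s < 1" for s x
    by (rule integral_real_bounded) (use B that in auto)
  have f1_le: "(\<integral>z. f1 s z \<partial>(M \<Otimes>\<^sub>M M)) \<le> N * B" if s: "0 < s" "s < 1" for s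
  proof -
    have "(\<integral>x. V x * (\<integral>y. W s x y \<partial>M) \<partial>M) \<le> (\<integral>x. V x * B \<partial>M)"
      using V W_mass[OF s] B by (intro integral_mono') (auto intro!: mult_left_mono)
    then show ?thesis using val_f1[OF s] by (simp add: N_def)
  qed
  have g1_f1: "0 \<le> g1 s z" "g1 s z \<le> f1 s z" if "0 < s" for s z
    using V nonneg that by (auto simp: g1_def f1_def indicator_def)
  have int_g1: "integrable (M \<Otimes>\<^sub>M M) (g1 s)" if s: "0 < s" "s < 1" for s
    by (rule Bochner_Integration.integrable_bound[OF int_f1[OF s]])
       (use g1_f1[OF s(1)] order_trans[OF g1_f1(1) g1_f1(2), OF s(1) s(1)] in auto)
  have int_g2: "integrable (M \<Otimes>\<^sub>M M) (g2 s)" if s: "0 < s" "s < 1" for s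
    unfolding swap using int_g1[OF s] by (simp only: P.integrable_product_swap_iff)
  have val_g2: "(\<integral>z. g2 s z \<partial>(M \<Otimes>\<^sub>M M)) = (\<integral>z. g1 s z \<partial>(M \<Otimes>\<^sub>M M))" for s
    unfolding swap by (rule P.integral_product_swap) measurable
  define \<phi> where "\<phi> s x = (\<integral>y. indicator {t. 0 \<le> t} (V y - V x) * W s x y \<partial>M)" for s x
  have [measurable]: "\<phi> s \<in> borel_measurable M" for s
    unfolding \<phi>_def[abs_def] by measurable
  have val_g1: "(\<integral>z. g1 s z \<partial>(M \<Otimes>\<^sub>M M)) = (\<integral>x. V x * \<phi> s x \<partial>M)" if s: "0 < s" "s < 1" for s
  proof -
    have "(\<integral>z. g1 s z \<partial>(M \<Otimes>\<^sub>M M)) = (\<integral>x. \<integral>y. g1 s (x, y) \<partial>M \<partial>M)"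
      using P.integral_fst'[OF int_g1[OF s]] by simp
    also have "\<dots> = (\<integral>x. V x * \<phi> s x \<partial>M)" by (simp add: g1_def \<phi>_def)
    finally show ?thesis .
  qed
  have lim_g: "((\<lambda>s. \<integral>x. V x * \<phi> s x \<partial>M) \<longlongrightarrow> (\<integral>x. 0 \<partial>M)) (at_right 0)"
  proof (rule dominated_convergence_at_right_0[where w="\<lambda>x. V x * B"])
    show "integrable M (\<lambda>x. V x * B)" using V by simp
    have \<phi>_nonneg: "0 \<le> \<phi> s x" if "0 < s" for s x
      unfolding \<phi>_def using nonneg[OF that] by (intro integral_nonneg_AE) auto
    show "\<forall>\<^sub>F s in at_right 0. AE x in M. \<bar>V x * \<phi> s x\<bar> \<le> V x * B"
      using eventually_at_right_real[of 0 "1::real", simplified]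
    proof eventually_elim
      case (elim s)
      have "\<phi> s x \<le> B" for x
        unfolding \<phi>_def
      proof (rule integral_real_bounded)
        have "(\<integral>\<^sup>+y. ennreal (indicator {t. 0 \<le> t} (V y - V x) * W s x y) \<partial>M) \<le> (\<integral>\<^sup>+y. ennreal (W s x y) \<partial>M)"
          using nonneg[of s] elim by (intro nn_integral_mono) (auto simp: indicator_def intro!: ennreal_leI)
        also have "\<dots> \<le> ennreal B" using B elim by auto
        finally show "(\<integral>\<^sup>+y. ennreal (indicator {t. 0 \<le> t} (V y - V x) * W s x y) \<partial>M) \<le> ennreal B" .
      qed (use B in auto)
      then show ?case using \<phi>_nonneg[of s] V elim by (auto simp: abs_mult intro!: mult_left_mono)
    qed
    show "AE x in M. ((\<lambda>s. V x * \<phi> s x) \<longlongrightarrow> 0) (at_right 0)"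
    proof (intro AE_I2)
      fix x
      show "((\<lambda>s. V x * \<phi> s x) \<longlongrightarrow> 0) (at_right 0)"
      proof (cases "V x = 0")
        case False
        then have Vx: "0 < V x" using V(2)[of x] by simp
        \<comment> \<open>Markov: this set has finite measure, so the kernel gives it mass at most \<open>s\<close> times a constant.\<close>
        define A where "A = {y \<in> space M. V x \<le> V y}"
        have [measurable]: "A \<in> sets M" unfolding A_def by measurable
        have "emeasure M A \<le> ennreal ((1 / V x) * (\<integral>x. V x \<partial>M))"
          unfolding A_def using integral_Markov_inequality[OF V(1) _ Vx] V(2) by simp
        then have fin: "emeasure M A < \<infinity>" by (rule order_le_less_trans) simp
        have "\<phi> s x \<le> s * measure M A" if "0 < s" for s
        proof -
          have "\<phi> s x \<le> (\<integral>y. s * indicator A y \<partial>M)"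
            unfolding \<phi>_def
          proof (rule integral_mono')
            show "integrable M (\<lambda>y. s * indicator A y :: real)" using fin by (intro integrable_mult_right) simp
          qed (use small[OF that] nonneg[OF that] that in \<open>auto simp: indicator_def A_def\<close>)
          also have "\<dots> = s * measure M A"
            by simp
          finally show ?thesis .
        qed
        then have "\<forall>\<^sub>F s in at_right 0. \<phi> s x \<le> s * measure M A"
          using eventually_at_right_less[of "0::real"] by (auto elim: eventually_mono)
        moreover have "\<forall>\<^sub>F s in at_right 0. 0 \<le> \<phi> s x"
          using eventually_at_right_less[of "0::real"] \<phi>_nonneg by (auto elim: eventually_mono)
        moreover have "((\<lambda>s. s * measure M A) \<longlongrightarrow> 0 * measure M A) (at_right 0)"
          by (intro tendsto_intros)
        ultimately have "((\<lambda>s. \<phi> s x) \<longlongrightarrow> 0) (at_right 0)"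
          by (intro tendsto_sandwich[of "\<lambda>_. 0" "\<lambda>s. \<phi> s x" _ "\<lambda>s. s * measure M A"]) auto
        then show ?thesis by (auto intro: tendsto_mult_right_zero)
      qed simp
    qed
  qed measurable
  have E_le: "\<bar>E s z - f1 s z - f2 s z\<bar> \<le> e * (f1 s z + f2 s z) + k * (g1 s z + g2 s z)"
    if k: "0 \<le> k" "\<And>a b :: real. \<bar>\<bar>a - b\<bar> powr p - \<bar>a\<bar> powr p - \<bar>b\<bar> powr p\<bar>
       \<le> e * (\<bar>a\<bar> powr p + \<bar>b\<bar> powr p) + k * min (\<bar>a\<bar> powr p) (\<bar>b\<bar> powr p)"
      and s: "0 < s" for e k s z
  proof -
    obtain x y where z: "z = (x, y)" by (cases z)
    have W0: "0 \<le> W s x y" using nonneg s by auto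
    have "\<bar>E s z - f1 s z - f2 s z\<bar> = \<bar>\<bar>u x - u y\<bar> powr p - V x - V y\<bar> * W s x y"
      using W0 by (simp add: E_def f1_def f2_def z abs_mult flip: left_diff_distrib)
    also have "\<dots> \<le> (e * (V x + V y) + k * min (V x) (V y)) * W s x y"
      using k(2)[of "u x" "u y"] W0 unfolding V_def by (rule mult_right_mono)
    also have "\<dots> = e * (f1 s z + f2 s z) + k * (min (V x) (V y) * W s x y)"
      by (simp add: f1_def f2_def z algebra_simps)
    also have "min (V x) (V y) * W s x y \<le> g1 s z + g2 s z"
      using W0 V(2)[of x] V(2)[of y] by (auto simp: g1_def g2_def z indicator_def min_def)
    finally show ?thesis using k(1) by (auto intro: mult_left_mono)
  qed
  have int_E: "integrable (M \<Otimes>\<^sub>M M) (E s)" if s: "0 < s" "s < 1" for s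
  proof -
    obtain k where k: "0 \<le> k" "\<And>a b :: real. \<bar>\<bar>a - b\<bar> powr p - \<bar>a\<bar> powr p - \<bar>b\<bar> powr p\<bar>
       \<le> 1 * (\<bar>a\<bar> powr p + \<bar>b\<bar> powr p) + k * min (\<bar>a\<bar> powr p) (\<bar>b\<bar> powr p)"
      using abs_diff_powr_almost_additive[OF p, of 1] by auto
    have "integrable (M \<Otimes>\<^sub>M M) (\<lambda>z. E s z - f1 s z - f2 s z)"
    proof (rule Bochner_Integration.integrable_bound)
      show "integrable (M \<Otimes>\<^sub>M M) (\<lambda>z. 1 * (f1 s z + f2 s z) + k * (g1 s z + g2 s z))"
        using int_f1[OF s] int_f2[OF s] int_g1[OF s] int_g2[OF s] by auto
      show "AE z in M \<Otimes>\<^sub>M M. norm (E s z - f1 s z - f2 s z) \<le> norm (1 * (f1 s z + f2 s z) + k * (g1 s z + g2 s z))"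
        using E_le[OF k s(1)] by (intro AE_I2) (smt (verit) real_norm_def)
    qed measurable
    from Bochner_Integration.integrable_add[OF Bochner_Integration.integrable_add[OF this int_f2[OF s]] int_f1[OF s]]
    show ?thesis by simp
  qed
  then show "\<And>s. 0 < s \<Longrightarrow> s < 1 \<Longrightarrow> integrable (M \<Otimes>\<^sub>M M) (\<lambda>(x, y). \<bar>u x - u y\<bar> powr p * W s x y)"
    unfolding E_def[abs_def] by (simp only: split_beta')
  have "((\<lambda>s. (\<integral>z. E s z \<partial>(M \<Otimes>\<^sub>M M)) - 2 * (\<integral>x. V x * (\<integral>y. W s x y \<partial>M) \<partial>M)) \<longlongrightarrow> 0) (at_right 0)"
  proof (rule tendstoI)
    fix \<eta> :: real assume \<eta>: "0 < \<eta>"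
    \<comment> \<open>chosen so that the main error \<open>2 e \<integral> U W\<^sub>s \<le> 2 e N B\<close> stays below \<open>\<eta> / 2\<close>; adding 1 covers \<open>N B = 0\<close>.\<close>
    define e where "e = \<eta> / (4 * (N * B + 1))"
    have NB: "0 \<le> N * B" using N B by auto
    have e: "0 < e" using \<eta> NB by (simp add: e_def)
    have eNB: "2 * e * (N * B) < \<eta> / 2"
    proof -
      have "2 * e * (N * B) < 2 * e * (N * B + 1)" using e by simp
      also have "\<dots> = \<eta> / 2" using NB by (simp add: e_def divide_simps)
      finally show ?thesis .
    qed
    obtain k where k: "0 \<le> k" "\<And>a b :: real. \<bar>\<bar>a - b\<bar> powr p - \<bar>a\<bar> powr p - \<bar>b\<bar> powr p\<bar>
       \<le> e * (\<bar>a\<bar> powr p + \<bar>b\<bar> powr p) + k * min (\<bar>a\<bar> powr p) (\<bar>b\<bar> powr p)"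
      using abs_diff_powr_almost_additive[OF p e] by auto
    have "((\<lambda>s. 2 * k * (\<integral>x. V x * \<phi> s x \<partial>M)) \<longlongrightarrow> 0) (at_right 0)"
      using tendsto_mult_left[OF lim_g, of "2 * k"] by simp
    then have "\<forall>\<^sub>F s in at_right 0. 2 * k * (\<integral>x. V x * \<phi> s x \<partial>M) < \<eta> / 2"
      using \<eta> by (intro order_tendstoD(2)) auto
    then show "\<forall>\<^sub>F s in at_right 0. dist ((\<integral>z. E s z \<partial>(M \<Otimes>\<^sub>M M)) - 2 * (\<integral>x. V x * (\<integral>y. W s x y \<partial>M) \<partial>M)) 0 < \<eta>"
      using eventually_at_right_real[of 0 "1::real", simplified]
    proof eventually_elim
      case (elim s)
      then have s: "0 < s" "s < 1" by auto
      note ints = int_f1[OF s] int_f2[OF s] int_g1[OF s] int_g2[OF s] int_E[OF s]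
      have "(\<integral>z. E s z \<partial>(M \<Otimes>\<^sub>M M)) - 2 * (\<integral>x. V x * (\<integral>y. W s x y \<partial>M) \<partial>M) = (\<integral>z. E s z - f1 s z - f2 s z \<partial>(M \<Otimes>\<^sub>M M))"
        using ints val_f1[OF s] val_f2[of s] by simp
      also have "\<bar>\<dots>\<bar> \<le> (\<integral>z. \<bar>E s z - f1 s z - f2 s z\<bar> \<partial>(M \<Otimes>\<^sub>M M))"
        using integral_norm_bound[of "M \<Otimes>\<^sub>M M" "\<lambda>z. E s z - f1 s z - f2 s z"] by simp
      also have "\<dots> \<le> (\<integral>z. e * (f1 s z + f2 s z) + k * (g1 s z + g2 s z) \<partial>(M \<Otimes>\<^sub>M M))"
        using ints E_le[OF k s(1)] by (intro integral_mono) auto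
      also have "\<dots> = 2 * e * (\<integral>z. f1 s z \<partial>(M \<Otimes>\<^sub>M M)) + 2 * k * (\<integral>x. V x * \<phi> s x \<partial>M)"
        using ints val_f2[of s] val_g2[of s] val_g1[OF s] by simp
      also have "2 * e * (\<integral>z. f1 s z \<partial>(M \<Otimes>\<^sub>M M)) \<le> 2 * e * (N * B)"
        using f1_le[OF s] e by (intro mult_left_mono) auto
      finally show ?case using elim eNB by (simp add: dist_real_def)
    qed
  qed
  then show "((\<lambda>s. (\<integral>(x, y). \<bar>u x - u y\<bar> powr p * W s x y \<partial>(M \<Otimes>\<^sub>M M))
          - 2 * (\<integral>x. \<bar>u x\<bar> powr p * (\<integral>y. W s x y \<partial>M) \<partial>M)) \<longlongrightarrow> 0) (at_right 0)"
    unfolding E_def[abs_def] V_def[abs_def] by (simp only: split_beta')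
qed

section \<open>Abel and Cesaro means of bounded functions\<close>

text \<open>The average \<open>\<lambda> \<integral> h(t) g(\<lambda>t) dt\<close> of a bounded function \<open>h\<close> is controlled by the \<open>L\<^sup>1\<close> norm of
  \<open>g\<close>, uniformly in \<open>\<lambda>\<close>. Consequently the functions \<open>g\<close> for which this average tends to zero form
  an \<open>L\<^sup>1\<close>-closed linear space (\<open>dilated_limit_closed\<close>) that is invariant under dilations
  (\<open>dilated_limit_scale\<close>). The indicator of \<open>[0, 1]\<close> gives Cesaro means and \<open>e\<^bsup>-t\<^esup>\<close> gives Abel
  means, so it suffices to see that this space contains one of them as soon as it contains the other.\<close>

lemma dilated_integrable:
  fixes h g :: "real \<Rightarrow> real"
  assumes [measurable]: "h \<in> borel_measurable borel" and h: "\<And>t. \<bar>h t\<bar> \<le> C"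
    and g: "integrable lborel g" and c: "0 < c"
  shows "integrable lborel (\<lambda>t. h t * g (c * t))"
    and "\<bar>c * (\<integral>t. h t * g (c * t) \<partial>lborel)\<bar> \<le> C * (\<integral>t. \<bar>g t\<bar> \<partial>lborel)"
proof -
  have [measurable]: "g \<in> borel_measurable borel" using g by auto
  have gc: "integrable lborel (\<lambda>t. g (c * t))"
    using lborel_integrable_real_affine[OF g, of c 0] c by simp
  show int: "integrable lborel (\<lambda>t. h t * g (c * t))"
    by (rule Bochner_Integration.integrable_bound[where f="\<lambda>t. C * g (c * t)"])
       (use order_trans[OF h abs_ge_self] gc in \<open>auto simp: abs_mult intro!: mult_right_mono\<close>)
  have "\<bar>\<integral>t. h t * g (c * t) \<partial>lborel\<bar> \<le> (\<integral>t. \<bar>h t * g (c * t)\<bar> \<partial>lborel)"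
    using integral_norm_bound[of lborel "\<lambda>t. h t * g (c * t)"] by simp
  also have "\<dots> \<le> (\<integral>t. C * \<bar>g (c * t)\<bar> \<partial>lborel)"
    using integrable_abs[OF int] gc h by (intro integral_mono) (auto simp: abs_mult intro!: mult_right_mono)
  also have "\<dots> = C * (\<integral>t. \<bar>g (c * t)\<bar> \<partial>lborel)" by simp
  also have "(\<integral>t. \<bar>g (c * t)\<bar> \<partial>lborel) = (\<integral>t. \<bar>g t\<bar> \<partial>lborel) / c"
    using lborel_integral_real_affine[of c "\<lambda>t. \<bar>g t\<bar>" 0] c by simp
  finally show "\<bar>c * (\<integral>t. h t * g (c * t) \<partial>lborel)\<bar> \<le> C * (\<integral>t. \<bar>g t\<bar> \<partial>lborel)"
    using c by (simp add: abs_mult field_simps)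
qed

lemma filterlim_times_at_right_0:
  fixes c :: real
  assumes "0 < c"
  shows "filterlim (\<lambda>l. l * c) (at_right 0) (at_right 0)"
  using filtermap_times_pos_at_right[OF assms, of 0]
  unfolding filterlim_def by (simp add: mult.commute[of _ c])

lemma dilated_limit_scale:
  fixes h g :: "real \<Rightarrow> real"
  assumes "((\<lambda>l. l * (\<integral>t. h t * g (l * t) \<partial>lborel)) \<longlongrightarrow> 0) (at_right 0)" "0 < c"
  shows "((\<lambda>l. l * (\<integral>t. h t * g (c * (l * t)) \<partial>lborel)) \<longlongrightarrow> 0) (at_right 0)"
proof -
  from filterlim_compose[OF assms(1) filterlim_times_at_right_0[OF assms(2)]]
  have "((\<lambda>l. (l * c) * (\<integral>t. h t * g ((l * c) * t) \<partial>lborel)) \<longlongrightarrow> 0) (at_right 0)" .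
  from tendsto_mult_left[OF this, of "1/c"] show ?thesis using assms(2)
    by (simp add: mult.assoc mult.left_commute[of _ c])
qed

lemma dilated_limit_closed:
  fixes h g :: "real \<Rightarrow> real"
  assumes hm: "h \<in> borel_measurable borel" and h: "\<And>t. \<bar>h t\<bar> \<le> C"
    and g: "integrable lborel g"
    and approx: "\<And>e. 0 < e \<Longrightarrow> \<exists>g'. integrable lborel g' \<and> (\<integral>t. \<bar>g t - g' t\<bar> \<partial>lborel) \<le> e
         \<and> ((\<lambda>l. l * (\<integral>t. h t * g' (l * t) \<partial>lborel)) \<longlongrightarrow> 0) (at_right 0)"
  shows "((\<lambda>l. l * (\<integral>t. h t * g (l * t) \<partial>lborel)) \<longlongrightarrow> 0) (at_right 0)"
proof (rule tendstoI)
  fix e :: real assume e: "0 < e"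
  have C: "0 \<le> C" using h[of 0] by auto
  define d where "d = e / (2 * (C + 1))"
  have d: "0 < d" using e C by (simp add: d_def)
  obtain g' where g': "integrable lborel g'" "(\<integral>t. \<bar>g t - g' t\<bar> \<partial>lborel) \<le> d"
    and lim: "((\<lambda>l. l * (\<integral>t. h t * g' (l * t) \<partial>lborel)) \<longlongrightarrow> 0) (at_right 0)"
    using approx[OF d] by blast
  have "\<forall>\<^sub>F l in at_right 0. dist (l * (\<integral>t. h t * g' (l * t) \<partial>lborel)) 0 < e / 2"
    using tendstoD[OF lim, of "e / 2"] e by simp
  then show "\<forall>\<^sub>F l in at_right 0. dist (l * (\<integral>t. h t * g (l * t) \<partial>lborel)) 0 < e"
    using eventually_at_right_less
  proof eventually_elim
    case (elim l)
    have "l * (\<integral>t. h t * (g (l * t) - g' (l * t)) \<partial>lborel) =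
      l * (\<integral>t. h t * g (l * t) \<partial>lborel) - l * (\<integral>t. h t * g' (l * t) \<partial>lborel)"
      using dilated_integrable(1)[OF hm h g elim(2)] dilated_integrable(1)[OF hm h g'(1) elim(2)]
      by (simp add: algebra_simps Bochner_Integration.integral_diff)
    moreover have "\<bar>l * (\<integral>t. h t * (g (l * t) - g' (l * t)) \<partial>lborel)\<bar> \<le> C * (\<integral>t. \<bar>g t - g' t\<bar> \<partial>lborel)"
      using dilated_integrable(2)[OF hm h Bochner_Integration.integrable_diff[OF g g'(1)] elim(2)] .
    moreover have "C * (\<integral>t. \<bar>g t - g' t\<bar> \<partial>lborel) \<le> C * d"
      using g'(2) C by (intro mult_left_mono)
    moreover have "C * d < e / 2"
    proof -
      have "C * d < (C + 1) * d" using d by (simp add: algebra_simps)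
      also have "(C + 1) * d = e / 2" using C by (simp add: d_def field_simps)
      finally show ?thesis .
    qed
    ultimately show ?case using elim(1) by (simp add: dist_real_def)
  qed
qed

lemma integrable_exp_half_line:
  fixes c b :: real
  assumes "0 < c"
  shows "integrable lborel (\<lambda>t. indicator {b..} t * exp (- c * t))"
    and "(\<integral>t. indicator {b..} t * exp (- c * t) \<partial>lborel) = exp (- c * b) / c"
    and "(\<integral>\<^sup>+t. ennreal (indicator {b..} t * exp (- c * t)) \<partial>lborel) = ennreal (exp (- c * b) / c)"
proof -
  have "(\<integral>\<^sup>+t. ennreal (exp (- c * t)) * indicator {b..} t \<partial>lborel) = ennreal (0 - (- exp (- c * b) / c))"
  proof (rule nn_integral_FTC_atLeast[where F="\<lambda>t. - exp (- c * t) / c" and T=0])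
    show "((\<lambda>t. - exp (- c * t) / c) \<longlongrightarrow> 0) at_top"
    proof -
      have "filterlim (\<lambda>t. - c * t) at_bot at_top"
        using assms by (intro filterlim_tendsto_neg_mult_at_bot[OF tendsto_const _ filterlim_ident]) auto
      from filterlim_compose[OF exp_at_bot this] have "((\<lambda>t. exp (- c * t)) \<longlongrightarrow> 0) at_top" .
      from tendsto_mult_left[OF this, of "- 1 / c"] show ?thesis by simp
    qed
  qed (use assms in \<open>auto intro!: derivative_eq_intros\<close>)
  then show nn: "(\<integral>\<^sup>+t. ennreal (indicator {b..} t * exp (- c * t)) \<partial>lborel) = ennreal (exp (- c * b) / c)"
    by (simp add: ennreal_mult' mult.commute ennreal_indicator)
  show "integrable lborel (\<lambda>t. indicator {b..} t * exp (- c * t))"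
    using nn by (intro integrableI_nonneg) auto
  show "(\<integral>t. indicator {b..} t * exp (- c * t) \<partial>lborel) = exp (- c * b) / c"
    using nn assms by (subst integral_eq_nn_integral) auto
qed

lemma integrable_indicator_Icc: "integrable lborel (indicator {a..b::real} :: real \<Rightarrow> real)"
  by (intro integrable_real_indicator) (auto simp: emeasure_lborel_Icc_eq)

text \<open>Karamata's argument. By dilation the space contains every \<open>e\<^bsup>-(i+1)t\<^esup>\<close>, hence every
  \<open>e\<^bsup>-t\<^esup> Q(e\<^bsup>-t\<^esup>)\<close> with a polynomial \<open>Q\<close>. By Weierstrass these approximate in \<open>L\<^sup>1\<close> every continuous
  function of compact support on the half-line, in particular a trapezoid that is close to the
  indicator of \<open>[0, 1]\<close>.\<close>

lemma tauberian_exp_to_interval: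
  fixes h :: "real \<Rightarrow> real"
  assumes hm: "h \<in> borel_measurable borel" and h: "\<And>t. \<bar>h t\<bar> \<le> C"
    and lim: "((\<lambda>l. l * (\<integral>t. h t * (indicator {0..} (l * t) * exp (- (l * t))) \<partial>lborel)) \<longlongrightarrow> 0) (at_right 0)"
  shows "((\<lambda>l. l * (\<integral>t. h t * indicator {0..1} (l * t) \<partial>lborel)) \<longlongrightarrow> 0) (at_right 0)"
proof (rule dilated_limit_closed[OF hm h])
  show "integrable lborel (indicator {0..1::real} :: real \<Rightarrow> real)" by simp
  fix e :: real assume e: "0 < e"
  define d where "d = min 1 (e / 2)"
  have d: "0 < d" "d \<le> 1" "d \<le> e / 2" using e by (auto simp: d_def)
  \<comment> \<open>a trapezoid that falls from 1 to 0 on \<open>[1, 1 + d]\<close>\<close>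
  define \<phi> :: "real \<Rightarrow> real" where "\<phi> t = max 0 (min 1 ((1 + d - t) / d))" for t
  \<comment> \<open>in the variable \<open>x = e\<^bsup>-t\<^esup>\<close> the trapezoid vanishes for \<open>x \<le> c\<close>, since \<open>1 + d \<le> 2\<close>;
    cutting at \<open>c\<close> keeps \<open>G\<close> continuous at zero\<close>
  define c where "c = exp (- 3 :: real)"
  define G where "G x = \<phi> (- ln (max x c)) / max x c" for x
  have c: "0 < c" by (simp add: c_def)
  have cont\<phi>: "continuous_on UNIV \<phi>"
    unfolding \<phi>_def using d by (intro continuous_intros) auto
  have "continuous_on {0..1} G"
    unfolding G_def
    by (intro continuous_intros continuous_on_compose2[OF cont\<phi>]) (use c in auto)
  then obtain Q where Q: "real_polynomial_function Q" and GQ: "\<And>x. x \<in> {0..1} \<Longrightarrow> \<bar>G x - Q x\<bar> < e / 2"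
    using Stone_Weierstrass_real_polynomial_function[of "{0..1}" G "e/2"] e by auto
  obtain a n where Qa: "Q = (\<lambda>x. \<Sum>i\<le>n. a i * x ^ i)"
    using Q real_polynomial_function_iff_sum by blast
  define g' where "g' t = indicator {0..} t * (exp (- t) * Q (exp (- t)))" for t :: real
  have "exp (- (real (Suc i) * t)) = exp (- t) * exp (- t) ^ i" for i t
    using exp_of_nat_mult[of "Suc i" "- t"] by simp
  then have g'_sum: "g' t = (\<Sum>i\<le>n. a i * (indicator {0..} t * exp (- (real (Suc i) * t))))" for t
    by (simp add: g'_def Qa sum_distrib_left mult.left_commute del: of_nat_Suc)
  have int_i: "integrable lborel (\<lambda>t::real. indicator {0..} t * exp (- (real (Suc i) * t)) :: real)" for i
    using integrable_exp_half_line(1)[of "real (Suc i)" 0, OF of_nat_0_less_iff[THEN iffD2, OF zero_less_Suc]]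
    by (simp only: mult_minus_left)
  have int_g': "integrable lborel g'"
    unfolding g'_sum[abs_def] using int_i by (intro Bochner_Integration.integrable_sum integrable_mult_right) 
  have \<phi>_eq: "\<phi> t = exp (- t) * G (exp (- t))" if "0 \<le> t" for t
  proof (cases "t \<le> 3")
    case True
    then have "max (exp (- t)) c = exp (- t)" by (simp add: c_def)
    then show ?thesis by (simp add: G_def)
  next
    case False
    then have "max (exp (- t)) c = c" by (simp add: c_def)
    moreover have "\<phi> t = 0" "\<phi> 3 = 0" using False d by (auto simp: \<phi>_def max_def min_def field_simps)
    ultimately show ?thesis by (simp add: G_def c_def)
  qed
  have pt: "\<bar>indicator {0..1} t - g' t\<bar> \<le> indicator {1..1+d} t + e / 2 * (indicator {0..} t * exp (- 1 * t))" for t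
  proof (cases "0 \<le> t")
    case True
    have "\<bar>indicator {0..1} t - \<phi> t\<bar> \<le> (indicator {1..1+d} t :: real)"
      using True d by (auto simp: \<phi>_def max_def min_def indicator_def field_simps)
    moreover have "\<bar>\<phi> t - g' t\<bar> \<le> e / 2 * exp (- t)"
    proof -
      have "\<phi> t - g' t = exp (- t) * (G (exp (- t)) - Q (exp (- t)))"
        using True by (simp add: g'_def \<phi>_eq algebra_simps)
      then have "\<bar>\<phi> t - g' t\<bar> = exp (- t) * \<bar>G (exp (- t)) - Q (exp (- t))\<bar>" by (simp add: abs_mult)
      also have "\<dots> \<le> exp (- t) * (e / 2)"
        using GQ[of "exp (- t)"] True by (intro mult_left_mono) auto
      finally show ?thesis by (simp add: mult.commute)
    qed
    moreover have "\<bar>indicator {0..1} t - g' t\<bar> \<le> \<bar>indicator {0..1} t - \<phi> t\<bar> + \<bar>\<phi> t - g' t\<bar>"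
      by (rule order_trans[OF _ abs_triangle_ineq]) simp
    ultimately have "\<bar>indicator {0..1} t - g' t\<bar> \<le> indicator {1..1+d} t + e / 2 * exp (- t)"
      by (meson add_mono order_trans)
    then show ?thesis using True by simp
  next
    case False
    then show ?thesis using d by (simp add: g'_def)
  qed
  have int_exp: "integrable lborel (\<lambda>t::real. indicator {0..} t * exp (- 1 * t) :: real)"
    and val_exp: "(\<integral>t. indicator {0..} t * exp (- 1 * t) \<partial>lborel) = (1::real)"
    using integrable_exp_half_line[of 1 0] by auto
  have "(\<integral>t. \<bar>indicator {0..1} t - g' t\<bar> \<partial>lborel) \<le> (\<integral>t. indicator {1..1+d} t + e / 2 * (indicator {0..} t * exp (- 1 * t)) \<partial>lborel)"
  proof (rule integral_mono)
    show "integrable lborel (\<lambda>t. indicator {1..1+d} t + e / 2 * (indicator {0..} t * exp (- 1 * t)))"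
      using int_exp integrable_indicator_Icc by (intro Bochner_Integration.integrable_add integrable_mult_right) auto
    show "integrable lborel (\<lambda>t. \<bar>indicator {0..1} t - g' t\<bar>)"
      using int_g' integrable_indicator_Icc by (intro integrable_abs Bochner_Integration.integrable_diff) auto
  qed (rule pt)
  also have "\<dots> = (\<integral>t. indicator {1..1+d} t \<partial>lborel) + e / 2 * (\<integral>t. indicator {0..} t * exp (- 1 * t) \<partial>lborel)"
    using int_exp integrable_indicator_Icc by (subst Bochner_Integration.integral_add) (auto intro!: integrable_mult_right)
  also have "\<dots> \<le> e" using d val_exp by simp
  finally have dist_g': "(\<integral>t. \<bar>indicator {0..1} t - g' t\<bar> \<partial>lborel) \<le> e" .
  have lim_i: "((\<lambda>l. l * (\<integral>t. h t * (indicator {0..} (l * t) * exp (- (real (Suc i) * (l * t)))) \<partial>lborel)) \<longlongrightarrow> 0) (at_right 0)" for i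
  proof -
    have "((\<lambda>l. l * (\<integral>t. h t * (indicator {0..} (real (Suc i) * (l * t)) * exp (- (real (Suc i) * (l * t)))) \<partial>lborel)) \<longlongrightarrow> 0) (at_right 0)"
      using dilated_limit_scale[OF lim, of "real (Suc i)"] by simp
    moreover have "indicator {0..} (real (Suc i) * x) = (indicator {0..} x :: real)" for x
      by (auto simp: indicator_def zero_le_mult_iff)
    ultimately show ?thesis by simp
  qed
  have "((\<lambda>l. \<Sum>i\<le>n. a i * (l * (\<integral>t. h t * (indicator {0..} (l * t) * exp (- (real (Suc i) * (l * t)))) \<partial>lborel))) \<longlongrightarrow> (\<Sum>i\<le>n. a i * 0)) (at_right 0)"
    by (intro tendsto_sum tendsto_mult_left lim_i)
  then have "((\<lambda>l. \<Sum>i\<le>n. a i * (l * (\<integral>t. h t * (indicator {0..} (l * t) * exp (- (real (Suc i) * (l * t)))) \<partial>lborel))) \<longlongrightarrow> 0) (at_right 0)"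
    by (simp only: mult_zero_right sum.neutral_const)
  then have "((\<lambda>l. l * (\<integral>t. h t * g' (l * t) \<partial>lborel)) \<longlongrightarrow> 0) (at_right 0)"
  proof (rule Lim_transform_eventually)
    show "\<forall>\<^sub>F l in at_right 0. (\<Sum>i\<le>n. a i * (l * (\<integral>t. h t * (indicator {0..} (l * t) * exp (- (real (Suc i) * (l * t)))) \<partial>lborel))) = l * (\<integral>t. h t * g' (l * t) \<partial>lborel)"
      using eventually_at_right_less
    proof eventually_elim
      case (elim l)
      have "(\<integral>t. h t * g' (l * t) \<partial>lborel) = (\<integral>t. (\<Sum>i\<le>n. a i * (h t * (indicator {0..} (l * t) * exp (- (real (Suc i) * (l * t)))))) \<partial>lborel)"
        unfolding g'_sum by (simp add: sum_distrib_left mult.left_commute)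
      also have "\<dots> = (\<Sum>i\<le>n. a i * (\<integral>t. h t * (indicator {0..} (l * t) * exp (- (real (Suc i) * (l * t)))) \<partial>lborel))"
        using dilated_integrable(1)[OF hm h int_i elim]
        by (subst Bochner_Integration.integral_sum) (auto intro!: integrable_mult_right)
      finally show ?case by (simp add: sum_distrib_left mult.left_commute)
    qed
  qed
  with int_g' dist_g' show "\<exists>g'. integrable lborel g' \<and> (\<integral>t. \<bar>indicator {0..1} t - g' t\<bar> \<partial>lborel) \<le> e
         \<and> ((\<lambda>l. l * (\<integral>t. h t * g' (l * t) \<partial>lborel)) \<longlongrightarrow> 0) (at_right 0)"
    by blast
qed

lemma integrable_linear_exp:
  "integrable lborel (\<lambda>a::real. indicator {0<..} a * (a * exp (- a)))"
proof (rule Bochner_Integration.integrable_bound)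
  show "integrable lborel (\<lambda>a::real. 2 * (indicator {0..} a * exp (- (1/2) * a)))"
    using integrable_exp_half_line(1)[of "1/2" 0] by (intro integrable_mult_right) simp
  have "a * exp (- a) \<le> 2 * exp (- (1/2) * a)" if "0 < a" for a :: real
  proof -
    have "a / 2 \<le> exp (a / 2)" using exp_ge_add_one_self[of "a/2"] by linarith
    then have "a * exp (- a) \<le> 2 * exp (a / 2) * exp (- a)" by (intro mult_right_mono) auto
    also have "\<dots> = 2 * exp (- (1/2) * a)" by (simp flip: exp_add)
    finally show ?thesis .
  qed
  then show "AE a in lborel. norm (indicator {0<..} a * (a * exp (- a))) \<le> norm (2 * (indicator {0..} a * exp (- (1/2) * a)) :: real)"
    by (auto simp: indicator_def)
qed measurable

text \<open>Since \<open>e\<^bsup>-\<tau>\<^esup> = \<integral> e\<^bsup>-a\<^esup> 1\<^bsub>[0, a]\<^esub>(\<tau>) da\<close>, the Abel mean is the integral of the Cesaro means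
  \<open>m(\<lambda>/a)\<close> against \<open>a e\<^bsup>-a\<^esup> da\<close>, and dominated convergence applies because Cesaro means of a
  bounded function are bounded.\<close>

lemma abelian_interval_to_exp:
  fixes h :: "real \<Rightarrow> real"
  assumes hm[measurable]: "h \<in> borel_measurable borel" and h: "\<And>t. \<bar>h t\<bar> \<le> C"
    and lim: "((\<lambda>l. l * (\<integral>t. h t * indicator {0..1} (l * t) \<partial>lborel)) \<longlongrightarrow> 0) (at_right 0)"
  shows "((\<lambda>l. l * (\<integral>t. h t * (indicator {0..} (l * t) * exp (- (l * t))) \<partial>lborel)) \<longlongrightarrow> 0) (at_right 0)"
proof -
  define m where "m l = l * (\<integral>t. h t * indicator {0..1} (l * t) \<partial>lborel)" for l
  have [measurable]: "m \<in> borel_measurable borel" unfolding m_def[abs_def] by measurable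
  have C: "0 \<le> C" using h[of 0] by auto
  have m_bound: "\<bar>m l\<bar> \<le> C" if "0 < l" for l
    using dilated_integrable(2)[OF hm h _ that, of "indicator {0..1}"] by (simp add: m_def)
  have formula: "l * (\<integral>t. h t * (indicator {0..} (l * t) * exp (- (l * t))) \<partial>lborel)
      = (\<integral>a. indicator {0<..} a * (a * exp (- a)) * m (l / a) \<partial>lborel)" if l: "0 < l" for l
  proof -
    \<comment> \<open>the first indicator in \<open>a\<close> says \<open>l t \<le> a\<close>; it is written as a function of \<open>a - l t\<close>
      to make joint measurability evident\<close>
    define F where "F t a = h t * (indicator {0..} t * (indicator {0..} (a - l * t) * exp (- 1 * a)))" for t a :: real
    have [measurable]: "case_prod F \<in> borel_measurable (lborel \<Otimes>\<^sub>M lborel)"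
      unfolding F_def[abs_def] by measurable
    have ind: "indicator {0..} (a - l * t) = (indicator {l * t..} a :: real)" for a t
      by (auto simp: indicator_def)
    have int_a: "integrable lborel (F t)" for t
      unfolding F_def[abs_def] ind using integrable_exp_half_line(1)[of 1 "l * t"] by (intro integrable_mult_right) simp
    have val_a: "(\<integral>a. F t a \<partial>lborel) = h t * (indicator {0..} t * exp (- l * t))" for t
      unfolding F_def[abs_def] ind using integrable_exp_half_line(2)[of 1 "l * t"] by simp
    have abs_a: "(\<integral>a. norm (F t a) \<partial>lborel) = \<bar>h t\<bar> * (indicator {0..} t * exp (- l * t))" for t
      unfolding F_def[abs_def] ind using integrable_exp_half_line(2)[of 1 "l * t"] by (simp add: abs_mult)
    have "integrable (lborel \<Otimes>\<^sub>M lborel) (case_prod F)"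
    proof (rule lborel_pair.Fubini_integrable)
      have "integrable lborel (\<lambda>t. \<bar>h t\<bar> * (indicator {0..} t * exp (- l * t)))"
        using dilated_integrable(1)[of "\<lambda>t. \<bar>h t\<bar>" C "\<lambda>t. indicator {0..} t * exp (- l * t)" 1]
          integrable_exp_half_line(1)[OF l, of 0] h by simp
      then show "integrable lborel (\<lambda>t. \<integral>a. norm (case_prod F (t, a)) \<partial>lborel)"
        by (simp only: prod.case abs_a)
    qed (use int_a in auto)
    then have "(\<integral>a. \<integral>t. F t a \<partial>lborel \<partial>lborel) = (\<integral>t. \<integral>a. F t a \<partial>lborel \<partial>lborel)"
      by (rule lborel_pair.Fubini_integral)
    also have "\<dots> = (\<integral>t. h t * (indicator {0..} (l * t) * exp (- (l * t))) \<partial>lborel)"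
      unfolding val_a using l by (auto simp: indicator_def zero_le_mult_iff intro!: Bochner_Integration.integral_cong)
    finally have "l * (\<integral>t. h t * (indicator {0..} (l * t) * exp (- (l * t))) \<partial>lborel)
       = (\<integral>a. l * (\<integral>t. F t a \<partial>lborel) \<partial>lborel)" by simp
    also have "\<dots> = (\<integral>a. indicator {0<..} a * (a * exp (- a)) * m (l / a) \<partial>lborel)"
    proof (rule integral_cong_AE)
      show "AE a in lborel. l * (\<integral>t. F t a \<partial>lborel) = indicator {0<..} a * (a * exp (- a)) * m (l / a)"
        using AE_lborel_singleton[of 0]
      proof eventually_elim
        case (elim a)
        show ?case
        proof (cases "0 < a")
          case True
          have "F t a = exp (- a) * (h t * indicator {0..1} (l / a * t))" for t
            using True l by (auto simp: F_def indicator_def field_simps zero_le_mult_iff)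
          then have "(\<integral>t. F t a \<partial>lborel) = exp (- a) * (\<integral>t. h t * indicator {0..1} (l / a * t) \<partial>lborel)"
            by simp
          then show ?thesis using True by (simp add: m_def)
        next
          case False
          have "F t a = 0" for t
          proof -
            have "a < l * t" if "0 \<le> t"
              using False elim mult_nonneg_nonneg[of l t] l that by linarith
            then show ?thesis by (auto simp: F_def indicator_def)
          qed
          then show ?thesis using False by simp
        qed
      qed
    qed measurable
    finally show ?thesis .
  qed
  have "((\<lambda>l. \<integral>a. indicator {0<..} a * (a * exp (- a)) * m (l / a) \<partial>lborel) \<longlongrightarrow> (\<integral>a. 0 \<partial>(lborel :: real measure))) (at_right 0)"
  proof (rule dominated_convergence_at_right_0[where w="\<lambda>a. C * (indicator {0<..} a * (a * exp (- a)))"])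
    show "integrable lborel (\<lambda>a. C * (indicator {0<..} a * (a * exp (- a))))"
      using integrable_linear_exp by (rule integrable_mult_right)
    show "\<forall>\<^sub>F l in at_right 0. AE a in lborel. \<bar>indicator {0<..} a * (a * exp (- a)) * m (l / a)\<bar> \<le> C * (indicator {0<..} a * (a * exp (- a)))"
      using eventually_at_right_less
    proof eventually_elim
      case (elim l)
      show ?case
      proof (intro AE_I2)
        fix a :: real
        show "\<bar>indicator {0<..} a * (a * exp (- a)) * m (l / a)\<bar> \<le> C * (indicator {0<..} a * (a * exp (- a)))"
          using m_bound[of "l / a"] elim by (auto simp: indicator_def abs_mult)
      qed
    qed
    show "AE a in lborel. ((\<lambda>l. indicator {0<..} a * (a * exp (- a)) * m (l / a)) \<longlongrightarrow> 0) (at_right 0)"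
    proof (intro AE_I2)
      fix a :: real
      show "((\<lambda>l. indicator {0<..} a * (a * exp (- a)) * m (l / a)) \<longlongrightarrow> 0) (at_right 0)"
      proof (cases "0 < a")
        case True
        then have "0 < 1 / a" by simp
        from filterlim_compose[OF lim[folded m_def] filterlim_times_at_right_0[OF this]]
        have "((\<lambda>l. m (l / a)) \<longlongrightarrow> 0) (at_right 0)" by simp
        from tendsto_mult_left[OF this, of "a * exp (- a)"] show ?thesis using True by simp
      qed simp
    qed
  qed measurable
  then have "((\<lambda>l. \<integral>a. indicator {0<..} a * (a * exp (- a)) * m (l / a) \<partial>lborel) \<longlongrightarrow> 0) (at_right 0)" by simp
  then show ?thesis
    by (rule Lim_transform_eventually) (use eventually_at_right_less[of "0::real"] formula in \<open>auto elim: eventually_mono\<close>)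
qed

text \<open>Subtracting the candidate limit from \<open>h\<close> and cutting off at negative times reduces to limit zero
  and a function that is bounded on the whole line.\<close>

lemma laplace_mean_iff_cesaro_mean:
  fixes h :: "real \<Rightarrow> real" and m :: real
  assumes hm[measurable]: "h \<in> borel_measurable borel" and h: "\<And>t. 0 \<le> t \<Longrightarrow> \<bar>h t\<bar> \<le> C"
  shows "((\<lambda>l. l * (LBINT t:{0..}. h t * exp (- l * t))) \<longlongrightarrow> m) (at_right 0)
     \<longleftrightarrow> ((\<lambda>T. 1 / T * (LBINT t:{0..T}. h t)) \<longlongrightarrow> m) at_top"
proof -
  define k where "k t = indicator {0..} t * (h t - m)" for t
  have [measurable]: "k \<in> borel_measurable borel" unfolding k_def[abs_def] by measurable
  have C: "0 \<le> C" using h[of 0] by auto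
  have k: "\<bar>k t\<bar> \<le> C + \<bar>m\<bar>" for t
    using h[of t] C by (auto simp: k_def indicator_def)
  have laplace: "l * (\<integral>t. k t * (indicator {0..} (l * t) * exp (- (l * t))) \<partial>lborel) = l * (LBINT t:{0..}. h t * exp (- l * t)) - m"
    if l: "0 < l" for l
  proof -
    have e: "integrable lborel (\<lambda>t. indicator {0..} t * exp (- l * t))"
      "(\<integral>t. indicator {0..} t * exp (- l * t) \<partial>lborel) = 1 / l"
      using integrable_exp_half_line[OF l, of 0] by auto
    have he: "integrable lborel (\<lambda>t. indicator {0..} t * (h t * exp (- l * t)))"
      by (rule Bochner_Integration.integrable_bound[where f="\<lambda>t. C * (indicator {0..} t * exp (- l * t))"])
         (use e(1) order_trans[OF h abs_ge_self] in \<open>auto simp: abs_mult indicator_def intro!: mult_right_mono\<close>)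
    have "(\<integral>t. k t * (indicator {0..} (l * t) * exp (- (l * t))) \<partial>lborel)
       = (\<integral>t. indicator {0..} t * (h t * exp (- l * t)) - m * (indicator {0..} t * exp (- l * t)) \<partial>lborel)"
      using l by (intro Bochner_Integration.integral_cong) (auto simp: k_def indicator_def zero_le_mult_iff algebra_simps)
    also have "\<dots> = (\<integral>t. indicator {0..} t * (h t * exp (- l * t)) \<partial>lborel) - m * (1 / l)"
      using e he by simp
    finally have eq: "(\<integral>t. k t * (indicator {0..} (l * t) * exp (- (l * t))) \<partial>lborel)
       = (\<integral>t. indicator {0..} t * (h t * exp (- l * t)) \<partial>lborel) - m * (1 / l)" .
    show ?thesis
      unfolding eq set_lebesgue_integral_def using l by (simp add: right_diff_distrib)
  qed
  have cesaro: "1 / T * (\<integral>t. k t * indicator {0..1} (1 / T * t) \<partial>lborel) = 1 / T * (LBINT t:{0..T}. h t) - m"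
    if T: "0 < T" for T
  proof -
    have "integrable lborel (\<lambda>t. C * indicator {0..T} t :: real)"
      by (intro integrable_mult_right integrable_indicator_Icc)
    then have "integrable lborel (\<lambda>t. indicator {0..T} t * h t)"
      by (rule Bochner_Integration.integrable_bound)
         (use order_trans[OF h abs_ge_self] C in \<open>auto simp: abs_mult indicator_def\<close>)
    moreover have "(\<integral>t. k t * indicator {0..1} (1 / T * t) \<partial>lborel)
       = (\<integral>t. indicator {0..T} t * h t - m * indicator {0..T} t \<partial>lborel)"
      using T by (intro Bochner_Integration.integral_cong) (auto simp: k_def indicator_def field_simps)
    ultimately have eq: "(\<integral>t. k t * indicator {0..1} (1 / T * t) \<partial>lborel)
       = (\<integral>t. indicator {0..T} t * h t \<partial>lborel) - m * T"
      using T integrable_indicator_Icc[of 0 T] by simp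
    show ?thesis
      unfolding eq set_lebesgue_integral_def using T by (simp add: right_diff_distrib)
  qed
  have "((\<lambda>l. l * (LBINT t:{0..}. h t * exp (- l * t))) \<longlongrightarrow> m) (at_right 0)
     \<longleftrightarrow> ((\<lambda>l. l * (LBINT t:{0..}. h t * exp (- l * t)) - m) \<longlongrightarrow> 0) (at_right 0)"
    by (rule LIM_zero_iff[symmetric])
  also have "\<dots> \<longleftrightarrow> ((\<lambda>l. l * (\<integral>t. k t * (indicator {0..} (l * t) * exp (- (l * t))) \<partial>lborel)) \<longlongrightarrow> 0) (at_right 0)"
    by (intro filterlim_cong refl) (use eventually_at_right_less[of "0::real"] laplace in \<open>auto elim!: eventually_mono\<close>)
  also have "\<dots> \<longleftrightarrow> ((\<lambda>l. l * (\<integral>t. k t * indicator {0..1} (l * t) \<partial>lborel)) \<longlongrightarrow> 0) (at_right 0)"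
    using tauberian_exp_to_interval[of k, OF _ k] abelian_interval_to_exp[of k, OF _ k] by auto
  also have "\<dots> \<longleftrightarrow> ((\<lambda>T. 1 / T * (\<integral>t. k t * indicator {0..1} (1 / T * t) \<partial>lborel)) \<longlongrightarrow> 0) at_top"
    unfolding filterlim_at_right_to_top by (simp add: inverse_eq_divide)
  also have "\<dots> \<longleftrightarrow> ((\<lambda>T. 1 / T * (LBINT t:{0..T}. h t) - m) \<longlongrightarrow> 0) at_top"
    by (intro filterlim_cong refl eventually_mono[OF eventually_gt_at_top[of "0::real"]] cesaro)
  also have "\<dots> \<longleftrightarrow> ((\<lambda>T. 1 / T * (LBINT t:{0..T}. h t)) \<longlongrightarrow> m) at_top"
    by (rule LIM_zero_iff)
  finally show ?thesis .
qed

section \<open>The tail potential under polynomial volume growth\<close>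

text \<open>The mean value theorem; it measures how little the kernel changes when its base point moves.\<close>

lemma abs_powr_neg_diff_le:
  fixes a b c \<beta> :: real
  assumes c: "0 < c" and ab: "c \<le> a" "c \<le> b" and \<beta>: "0 \<le> \<beta>"
  shows "\<bar>a powr (- \<beta>) - b powr (- \<beta>)\<bar> \<le> \<beta> * \<bar>a - b\<bar> * c powr (- \<beta> - 1)"
proof -
  have less: "\<bar>a powr (- \<beta>) - b powr (- \<beta>)\<bar> \<le> \<beta> * \<bar>a - b\<bar> * c powr (- \<beta> - 1)" if a: "c \<le> a" "a < b" for a b
  proof -
    have "\<exists>z. a < z \<and> z < b \<and> b powr (- \<beta>) - a powr (- \<beta>) = (b - a) * (- \<beta> * z powr (- \<beta> - 1))"
      using a c by (intro MVT2) (auto intro!: derivative_eq_intros)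
    then obtain z where z: "a < z" "b powr (- \<beta>) - a powr (- \<beta>) = (b - a) * (- \<beta> * z powr (- \<beta> - 1))"
      by blast
    have "\<bar>a powr (- \<beta>) - b powr (- \<beta>)\<bar> = \<beta> * \<bar>a - b\<bar> * z powr (- \<beta> - 1)"
      using z(2) a \<beta> by (simp add: abs_minus_commute[of "a powr _"] abs_mult)
    also have "z powr (- \<beta> - 1) \<le> c powr (- \<beta> - 1)"
      using z(1) a c \<beta> by (intro powr_mono2') auto
    finally show ?thesis using \<beta> by (simp add: mult_left_mono)
  qed
  show ?thesis
    using less[of a b] less[of b a] ab by (cases a b rule: linorder_cases) (auto simp: abs_minus_commute)
qed

locale volume_growth =
  fixes \<mu> :: "'a::polish_space measure" and \<alpha> C p :: real
  assumes borel[measurable_cong]: "sets \<mu> = sets borel"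
    and \<alpha>: "0 < \<alpha>" and C: "0 < C" and p: "1 \<le> p"
    and growth: "\<And>x r. 1 \<le> r \<Longrightarrow> emeasure \<mu> (cball x r) \<le> ennreal (C * r powr \<alpha>)"
begin

lemma space_\<mu>[simp]: "space \<mu> = UNIV"
  using sets_eq_imp_space_eq[OF borel] by simp

lemma emeasure_cball_finite: "emeasure \<mu> (cball x r) < \<infinity>"
proof -
  have "emeasure \<mu> (cball x r) \<le> emeasure \<mu> (cball x (max 1 r))"
    by (intro emeasure_mono) (auto simp: borel)
  also have "\<dots> \<le> ennreal (C * max 1 r powr \<alpha>)" by (rule growth) simp
  finally show ?thesis by (rule order_le_less_trans) simp
qed

sublocale sigma_finite_measure \<mu>
proof
  fix x :: 'a
  let ?A = "range (\<lambda>n::nat. cball (undefined :: 'a) (real n))"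
  have "\<Union>?A = space \<mu>"
    using real_arch_simple by (auto simp: cball_def)
  then show "\<exists>A. countable A \<and> A \<subseteq> sets \<mu> \<and> \<Union> A = space \<mu> \<and> (\<forall>a\<in>A. emeasure \<mu> a \<noteq> \<infinity>)"
    using emeasure_cball_finite by (intro exI[of _ ?A]) (auto simp: borel less_top[symmetric])
qed

lemma ball_volume_mono: "r \<le> r' \<Longrightarrow> ball_volume \<mu> x r \<le> ball_volume \<mu> x r'"
  unfolding ball_volume_def
  using emeasure_cball_finite[of x r']
  by (intro measure_mono_fmeasurable fmeasurableI) (auto simp: borel)

lemma ball_volume_le: "1 \<le> r \<Longrightarrow> ball_volume \<mu> x r \<le> C * r powr \<alpha>"
  unfolding ball_volume_def measure_def using growth[of r x] C by (intro enn2real_leI) auto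

lemma measurable_log_density[measurable]: "log_density \<mu> \<alpha> x \<in> borel_measurable borel"
proof -
  have [measurable]: "(\<lambda>t. ball_volume \<mu> x (exp t)) \<in> borel_measurable borel"
    by (intro borel_measurable_mono monoI ball_volume_mono) simp
  show ?thesis unfolding log_density_def[abs_def] by measurable
qed

lemma log_density_bounds:
  shows "0 \<le> log_density \<mu> \<alpha> x t" and "0 \<le> t \<Longrightarrow> log_density \<mu> \<alpha> x t \<le> C"
proof -
  show "0 \<le> log_density \<mu> \<alpha> x t" by (simp add: log_density_def ball_volume_def)
  assume "0 \<le> t"
  then have "exp (- \<alpha> * t) * ball_volume \<mu> x (exp t) \<le> exp (- \<alpha> * t) * (C * exp t powr \<alpha>)"
    by (intro mult_left_mono ball_volume_le) auto
  also have "\<dots> = C" by (simp add: powr_def exp_minus field_simps)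
  finally show "log_density \<mu> \<alpha> x t \<le> C" by (simp add: log_density_def)
qed

text \<open>The functionals of the theorem take values in \<open>[0, \<infinity>]\<close>. The kernel and its mass are
  finite, and so is the far energy of an \<open>L\<^sup>p\<close> function for \<open>s < 1\<close>; their real-valued versions
  can be subtracted from each other.\<close>

definition tail_kernel :: "real \<Rightarrow> 'a \<Rightarrow> 'a \<Rightarrow> real" where
  "tail_kernel s x y = (if 1 < dist x y then s * dist x y powr (- \<alpha> - s * p) else 0)"

definition tail_mass :: "real \<Rightarrow> 'a \<Rightarrow> real" where
  "tail_mass s x = (\<integral>y. tail_kernel s x y \<partial>\<mu>)"

definition laplace_mean :: "'a \<Rightarrow> real \<Rightarrow> real" where
  "laplace_mean x l = l * (LBINT t:{0..}. log_density \<mu> \<alpha> x t * exp (- l * t))"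

lemma tail_kernel_measurable[measurable]:
  "(\<lambda>(x, y). tail_kernel s x y) \<in> borel_measurable (\<mu> \<Otimes>\<^sub>M \<mu>)"
  unfolding tail_kernel_def split_beta' by measurable

lemma tail_kernel_measurable'[measurable]: "tail_kernel s x \<in> borel_measurable \<mu>"
  unfolding tail_kernel_def[abs_def] by measurable

lemma tail_kernel_nonneg: "0 < s \<Longrightarrow> 0 \<le> tail_kernel s x y"
  by (simp add: tail_kernel_def)

lemma tail_kernel_le: "0 < s \<Longrightarrow> tail_kernel s x y \<le> s"
proof -
  assume s: "0 < s"
  have "dist x y powr (- \<alpha> - s * p) \<le> 1" if "1 < dist x y"
  proof -
    have "- \<alpha> - s * p \<le> 0" using \<alpha> s p mult_pos_pos[of s p] by linarith
    then show ?thesis using powr_mono[of "- \<alpha> - s * p" 0 "dist x y"] that by (simp split: if_splits)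
  qed
  then show ?thesis using s by (simp add: tail_kernel_def)
qed

lemma tail_kernel_sym: "tail_kernel s x y = tail_kernel s y x"
  by (simp add: tail_kernel_def dist_commute)

lemma integrable_log_density_exp:
  assumes "0 < l"
  shows "integrable lborel (\<lambda>t. indicator {0..} t * (log_density \<mu> \<alpha> x t * exp (- l * t)))"
proof -
  have "integrable lborel (\<lambda>t. C * (indicator {0..} t * exp (- l * t)))"
    using integrable_exp_half_line(1)[OF assms, of 0] by (rule integrable_mult_right)
  then show ?thesis
    by (rule Bochner_Integration.integrable_bound)
       (use log_density_bounds C in \<open>auto simp: abs_mult indicator_def\<close>)
qed

lemma laplace_mean_le: assumes l: "0 < l" shows "laplace_mean x l \<le> C"
proof -
  have "(LBINT t:{0..}. log_density \<mu> \<alpha> x t * exp (- l * t)) \<le> (\<integral>t. C * (indicator {0..} t * exp (- l * t)) \<partial>lborel)"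
    unfolding set_lebesgue_integral_def
    using integrable_exp_half_line(1)[OF l, of 0] integrable_log_density_exp[OF l, of x] log_density_bounds(2)
    by (intro integral_mono) (auto simp: indicator_def)
  also have "\<dots> = C / l"
    using integrable_exp_half_line(2)[OF l, of 0] by simp
  finally show ?thesis
    using l by (simp add: laplace_mean_def field_simps)
qed

text \<open>Layer cake: for \<open>d(x, y) > 1\<close> and \<open>\<beta> = \<alpha> + sp\<close> the power \<open>d(x, y)\<^bsup>-\<beta>\<^esup>\<close> is the integral of
  \<open>\<beta> e\<^bsup>-\<beta>t\<^esup>\<close> over \<open>t \<ge> log d(x, y)\<close>. Integrating first in \<open>y\<close> leaves the volume of the annulus between
  the radii \<open>1\<close> and \<open>e\<^sup>t\<close>, and \<open>e\<^bsup>-\<beta>t\<^esup> V(e\<^sup>t) = h(t) e\<^bsup>-spt\<^esup>\<close>. The nonnegativity is recorded as well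
  because \<open>ennreal\<close> would silently truncate a negative value.\<close>

lemma
  assumes s: "0 < s"
  shows nn_integral_tail_kernel: "(\<integral>\<^sup>+y. ennreal (tail_kernel s x y) \<partial>\<mu>)
     = ennreal ((\<alpha> + s * p) / p * laplace_mean x (s * p) - s * ball_volume \<mu> x 1)"
    and tail_formula_nonneg: "0 \<le> (\<alpha> + s * p) / p * laplace_mean x (s * p) - s * ball_volume \<mu> x 1"
proof -
  define \<beta> where "\<beta> = \<alpha> + s * p"
  have sp: "0 < s * p" using s p by simp
  then have \<beta>: "0 < \<beta>" using \<alpha> by (simp add: \<beta>_def)
  have exp_split: "exp (- \<beta> * t) = exp (- \<alpha> * t) * exp (- (s * p) * t)" for t
    by (simp add: \<beta>_def algebra_simps flip: exp_add)
  define F where "F y t = (if 1 < dist x y \<and> dist x y \<le> exp t \<and> 0 \<le> t then s * \<beta> * exp (- \<beta> * t) else 0)" for y t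
  interpret L: pair_sigma_finite \<mu> "lborel :: real measure" ..
  have [measurable]: "(\<lambda>(y, t). F y t) \<in> borel_measurable (\<mu> \<Otimes>\<^sub>M lborel)"
    unfolding F_def split_beta' by measurable
  have slice_y: "(\<integral>\<^sup>+t. ennreal (F y t) \<partial>lborel) = ennreal (tail_kernel s x y)" for y
  proof (cases "1 < dist x y")
    case True
    then have "exp (ln (dist x y)) = dist x y" by (intro exp_ln) linarith
    then have "dist x y \<le> exp t \<longleftrightarrow> ln (dist x y) \<le> t" for t
      by (metis exp_le_cancel_iff)
    then have "F y t = s * \<beta> * (indicator {ln (dist x y)..} t * exp (- \<beta> * t))" for t
      using True ln_gt_zero[OF True] by (auto simp: F_def indicator_def)
    then have "(\<integral>\<^sup>+t. ennreal (F y t) \<partial>lborel) = ennreal (s * \<beta>) * (\<integral>\<^sup>+t. ennreal (indicator {ln (dist x y)..} t * exp (- \<beta> * t)) \<partial>lborel)"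
      using s \<beta> by (simp add: ennreal_mult nn_integral_cmult)
    also have "\<dots> = ennreal (s * \<beta> * (exp (- \<beta> * ln (dist x y)) / \<beta>))"
      unfolding integrable_exp_half_line(3)[OF \<beta>] using s \<beta> by (intro ennreal_mult[symmetric]) auto
    also have "s * \<beta> * (exp (- \<beta> * ln (dist x y)) / \<beta>) = tail_kernel s x y"
    proof -
      have "x \<noteq> y" using True by auto
      then show ?thesis using True \<beta> by (simp add: tail_kernel_def powr_def \<beta>_def)
    qed
    finally show ?thesis .
  qed (simp add: F_def tail_kernel_def)
  have slice_t: "(\<integral>\<^sup>+y. ennreal (F y t) \<partial>\<mu>)
      = ennreal (s * \<beta> * (indicator {0..} t * (log_density \<mu> \<alpha> x t * exp (- (s * p) * t)) - ball_volume \<mu> x 1 * (indicator {0..} t * exp (- \<beta> * t))))" for t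
  proof (cases "0 \<le> t")
    case True
    have "(\<integral>\<^sup>+y. ennreal (F y t) \<partial>\<mu>) = (\<integral>\<^sup>+y. ennreal (s * \<beta> * exp (- \<beta> * t)) * indicator (cball x (exp t) - cball x 1) y \<partial>\<mu>)"
      using True by (intro nn_integral_cong) (auto simp: F_def indicator_def)
    also have "\<dots> = ennreal (s * \<beta> * exp (- \<beta> * t)) * emeasure \<mu> (cball x (exp t) - cball x 1)"
      by (rule nn_integral_cmult_indicator) (auto simp: borel)
    also have "emeasure \<mu> (cball x (exp t) - cball x 1) = ennreal (ball_volume \<mu> x (exp t) - ball_volume \<mu> x 1)"
    proof -
      have "cball x 1 \<subseteq> cball x (exp t)" using True by (intro subset_cball) simp
      then have "measure \<mu> (cball x (exp t) - cball x 1) = ball_volume \<mu> x (exp t) - ball_volume \<mu> x 1"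
        unfolding ball_volume_def using emeasure_cball_finite[of x "exp t"]
        by (intro measure_Diff) (auto simp: borel)
      moreover have "emeasure \<mu> (cball x (exp t) - cball x 1) \<le> emeasure \<mu> (cball x (exp t))"
        by (intro emeasure_mono) (auto simp: borel)
      ultimately show ?thesis
        using emeasure_cball_finite[of x "exp t"] by (subst emeasure_eq_ennreal_measure) (auto simp: top_unique)
    qed
    also have "ennreal (s * \<beta> * exp (- \<beta> * t)) * \<dots> = ennreal (s * \<beta> * exp (- \<beta> * t) * (ball_volume \<mu> x (exp t) - ball_volume \<mu> x 1))"
      using s \<beta> True by (intro ennreal_mult[symmetric]) (auto intro!: ball_volume_mono)
    also have "s * \<beta> * exp (- \<beta> * t) * (ball_volume \<mu> x (exp t) - ball_volume \<mu> x 1)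
       = s * \<beta> * (indicator {0..} t * (log_density \<mu> \<alpha> x t * exp (- (s * p) * t)) - ball_volume \<mu> x 1 * (indicator {0..} t * exp (- \<beta> * t)))"
      using True exp_split[of t] by (simp add: log_density_def algebra_simps)
    finally show ?thesis .
  qed (simp add: F_def)
  let ?g = "\<lambda>t. s * \<beta> * (indicator {0..} t * (log_density \<mu> \<alpha> x t * exp (- (s * p) * t)) - ball_volume \<mu> x 1 * (indicator {0..} t * exp (- \<beta> * t)))"
  have int_g: "integrable lborel ?g"
    using integrable_log_density_exp[OF sp, of x] integrable_exp_half_line(1)[OF \<beta>, of 0]
    by (intro integrable_mult_right Bochner_Integration.integrable_diff) auto
  have g_nonneg: "0 \<le> ?g t" for t
  proof (cases "0 \<le> t")
    case True
    have "?g t = s * \<beta> * exp (- \<beta> * t) * (ball_volume \<mu> x (exp t) - ball_volume \<mu> x 1)"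
      using True exp_split[of t] by (simp add: log_density_def algebra_simps)
    moreover have "0 \<le> ball_volume \<mu> x (exp t) - ball_volume \<mu> x 1"
      using True ball_volume_mono[of 1 "exp t" x] by simp
    ultimately show ?thesis using s \<beta> by simp
  qed simp
  have g_eq: "(\<integral>t. ?g t \<partial>lborel) = s * \<beta> * ((LBINT t:{0..}. log_density \<mu> \<alpha> x t * exp (- (s * p) * t)) - ball_volume \<mu> x 1 * (1 / \<beta>))"
    using integrable_log_density_exp[OF sp, of x] integrable_exp_half_line[OF \<beta>, of 0]
    by (simp add: set_lebesgue_integral_def)
  also have "\<dots> = (\<alpha> + s * p) / p * laplace_mean x (s * p) - s * ball_volume \<mu> x 1"
    unfolding laplace_mean_def \<beta>_def[symmetric] using \<beta> s p by (simp add: field_simps)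
  finally have val_g: "(\<integral>t. ?g t \<partial>lborel) = (\<alpha> + s * p) / p * laplace_mean x (s * p) - s * ball_volume \<mu> x 1" .
  show "0 \<le> (\<alpha> + s * p) / p * laplace_mean x (s * p) - s * ball_volume \<mu> x 1"
    unfolding val_g[symmetric] using g_nonneg by (intro integral_nonneg_AE) auto
  have "(\<integral>\<^sup>+t. \<integral>\<^sup>+y. ennreal (F y t) \<partial>\<mu> \<partial>lborel) = (\<integral>\<^sup>+y. \<integral>\<^sup>+t. ennreal (F y t) \<partial>lborel \<partial>\<mu>)"
    by (rule L.Fubini') measurable
  then have "(\<integral>\<^sup>+y. ennreal (tail_kernel s x y) \<partial>\<mu>) = (\<integral>\<^sup>+t. ennreal (?g t) \<partial>lborel)"
    by (simp only: slice_y slice_t)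
  also have "\<dots> = ennreal (\<integral>t. ?g t \<partial>lborel)"
    using int_g g_nonneg by (intro nn_integral_eq_integral) auto
  finally show "(\<integral>\<^sup>+y. ennreal (tail_kernel s x y) \<partial>\<mu>)
     = ennreal ((\<alpha> + s * p) / p * laplace_mean x (s * p) - s * ball_volume \<mu> x 1)"
    by (simp only: val_g)
qed

lemma nn_integral_tail_kernel_le:
  assumes s: "0 < s" "s < 1"
  shows "(\<integral>\<^sup>+y. ennreal (tail_kernel s x y) \<partial>\<mu>) \<le> ennreal ((\<alpha> + p) / p * C)"
  unfolding nn_integral_tail_kernel[OF s(1)]
proof (rule ennreal_leI)
  have "(\<alpha> + s * p) / p * laplace_mean x (s * p) \<le> (\<alpha> + s * p) / p * C"
    using s p \<alpha> by (intro mult_left_mono laplace_mean_le) auto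
  also have "\<dots> \<le> (\<alpha> + p) / p * C"
    using s p C by (intro mult_right_mono divide_right_mono) auto
  finally show "(\<alpha> + s * p) / p * laplace_mean x (s * p) - s * ball_volume \<mu> x 1 \<le> (\<alpha> + p) / p * C"
    using s by (smt (verit) ball_volume_def measure_nonneg mult_nonneg_nonneg)
qed

lemma integrable_tail_kernel: "0 < s \<Longrightarrow> integrable \<mu> (tail_kernel s x)"
  using nn_integral_tail_kernel[of s x] tail_kernel_nonneg[of s x] by (intro integrableI_nonneg) auto

lemma nn_integral_tail: "0 < s \<Longrightarrow> (\<integral>\<^sup>+y. ennreal (tail_kernel s x y) \<partial>\<mu>) = ennreal (tail_mass s x)"
  unfolding tail_mass_def using integrable_tail_kernel tail_kernel_nonneg by (intro nn_integral_eq_integral) auto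

lemma tail_mass_nonneg: "0 < s \<Longrightarrow> 0 \<le> tail_mass s x"
  unfolding tail_mass_def using tail_kernel_nonneg by (intro integral_nonneg_AE) auto

lemma tail_mass_le: "0 < s \<Longrightarrow> s < 1 \<Longrightarrow> tail_mass s x \<le> (\<alpha> + p) / p * C"
  using nn_integral_tail_kernel_le[of s x] nn_integral_tail[of s x] \<alpha> p C by simp

lemma tail_mass_eq:
  assumes s: "0 < s"
  shows "tail_mass s x = (\<alpha> + s * p) / p * laplace_mean x (s * p) - s * ball_volume \<mu> x 1"
  using nn_integral_tail[OF s, of x] nn_integral_tail_kernel[OF s, of x]
    tail_formula_nonneg[OF s, of x] tail_mass_nonneg[OF s, of x] by simp

lemma integrable_far_power: "integrable \<mu> (\<lambda>y. if 1 < dist x y then dist x y powr (- \<alpha> - 1) else 0)"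
proof -
  have "integrable \<mu> (\<lambda>y. p * tail_kernel (1 / p) x y)"
    \<comment> \<open>at \<open>s = 1 / p\<close> the kernel has exponent \<open>-\<alpha> - 1\<close>\<close>
    using p by (intro integrable_mult_right integrable_tail_kernel) auto
  moreover have "p * tail_kernel (1 / p) x y = (if 1 < dist x y then dist x y powr (- \<alpha> - 1) else 0)" for y
    using p by (simp add: tail_kernel_def)
  ultimately show ?thesis by simp
qed

text \<open>Points far from \<open>z\<close> have distances to \<open>x\<close> and to \<open>z\<close> that differ by at most \<open>D = d(x, z)\<close> and are
  both at least \<open>d(z, y) / 2\<close>, so the kernels differ by \<open>O(s d(z, y)\<^bsup>-\<alpha>-1\<^esup>)\<close>, and this power is
  integrable away from \<open>z\<close>. On the remaining ball of finite measure the kernels are at most \<open>s\<close>.\<close>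

lemma tail_mass_base_point:
  "\<exists>K. \<forall>s. 0 < s \<longrightarrow> s < 1 \<longrightarrow> \<bar>tail_mass s x - tail_mass s z\<bar> \<le> K * s"
proof -
  define D where "D = dist x z"
  \<comment> \<open>the second summand is \<open>(\<alpha> + p) D (d(z, y) / 2)\<^bsup>-\<alpha>-1\<^esup>\<close>, the mean value bound with \<open>\<beta> = \<alpha> + sp\<close>
    replaced by \<open>\<alpha> + p\<close> in the factor and by \<open>\<alpha>\<close> in the exponent\<close>
  define w where "w y = indicator (cball z (2 * D + 2)) y
     + (\<alpha> + p) * D * (1 / 2) powr (- \<alpha> - 1) * (if 1 < dist z y then dist z y powr (- \<alpha> - 1) else 0)" for y
  have D: "0 \<le> D" by (simp add: D_def)
  have int_w: "integrable \<mu> w"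
    unfolding w_def using integrable_far_power[of z] emeasure_cball_finite[of z "2 * D + 2"]
    by (intro Bochner_Integration.integrable_add integrable_mult_right integrable_real_indicator)
       (auto simp: borel)
  have diff: "\<bar>tail_kernel s x y - tail_kernel s z y\<bar> \<le> s * w y" if s: "0 < s" "s < 1" for s y
  proof (cases "dist z y \<le> 2 * D + 2")
    case True
    have "\<bar>tail_kernel s x y - tail_kernel s z y\<bar> \<le> s"
      using tail_kernel_nonneg[OF s(1), of x y] tail_kernel_nonneg[OF s(1), of z y]
        tail_kernel_le[OF s(1), of x y] tail_kernel_le[OF s(1), of z y] by linarith
    also have "s \<le> s * w y"
      using True s \<alpha> p D by (simp add: w_def)
    finally show ?thesis .
  next
    case False
    define c where "c = dist z y / 2"
    define \<beta> where "\<beta> = \<alpha> + s * p"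
    have tri: "dist z y \<le> dist x y + D" "\<bar>dist x y - dist z y\<bar> \<le> D"
      unfolding D_def by metric+
    then have far: "1 < c" "c \<le> dist x y" "c \<le> dist z y"
      using False D by (auto simp: c_def)
    have \<beta>: "0 < \<beta>" "\<alpha> \<le> \<beta>" "\<beta> \<le> \<alpha> + p"
    proof -
      have "0 < s * p" "s * p \<le> p" using s p by auto
      then show "0 < \<beta>" "\<alpha> \<le> \<beta>" "\<beta> \<le> \<alpha> + p" using \<alpha> by (simp_all add: \<beta>_def)
    qed
    have "\<bar>tail_kernel s x y - tail_kernel s z y\<bar> = s * \<bar>dist x y powr (- \<beta>) - dist z y powr (- \<beta>)\<bar>"
      using far s by (simp add: tail_kernel_def \<beta>_def abs_mult flip: right_diff_distrib)
    also have "\<dots> \<le> s * (\<beta> * \<bar>dist x y - dist z y\<bar> * c powr (- \<beta> - 1))"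
      using far \<beta> s by (intro mult_left_mono abs_powr_neg_diff_le) auto
    also have "\<dots> \<le> s * ((\<alpha> + p) * D * c powr (- \<alpha> - 1))"
      using far \<beta> s tri D by (intro mult_left_mono mult_mono powr_mono) auto
    also have "c powr (- \<alpha> - 1) = (1 / 2) powr (- \<alpha> - 1) * dist z y powr (- \<alpha> - 1)"
      unfolding c_def by (simp flip: powr_mult)
    also have "s * ((\<alpha> + p) * D * ((1 / 2) powr (- \<alpha> - 1) * dist z y powr (- \<alpha> - 1))) = s * w y"
      using False far by (simp add: w_def)
    finally show ?thesis .
  qed
  have "\<bar>tail_mass s x - tail_mass s z\<bar> \<le> (\<integral>y. w y \<partial>\<mu>) * s" if s: "0 < s" "s < 1" for s
  proof -
    note int = integrable_tail_kernel[OF s(1)]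
    have "\<bar>tail_mass s x - tail_mass s z\<bar> = \<bar>\<integral>y. tail_kernel s x y - tail_kernel s z y \<partial>\<mu>\<bar>"
      unfolding tail_mass_def using int by simp
    also have "\<dots> \<le> (\<integral>y. \<bar>tail_kernel s x y - tail_kernel s z y\<bar> \<partial>\<mu>)"
      using integral_norm_bound[of \<mu> "\<lambda>y. tail_kernel s x y - tail_kernel s z y"] by simp
    also have "\<dots> \<le> (\<integral>y. s * w y \<partial>\<mu>)"
      using int int_w diff[OF s] by (intro integral_mono) auto
    finally show ?thesis by (simp add: mult.commute)
  qed
  then show ?thesis by blast
qed

lemma tail_mass_base_point_limit: "((\<lambda>s. tail_mass s x - tail_mass s z) \<longlongrightarrow> 0) (at_right 0)"
proof -
  obtain K where K: "\<And>s. 0 < s \<Longrightarrow> s < 1 \<Longrightarrow> \<bar>tail_mass s x - tail_mass s z\<bar> \<le> K * s"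
    using tail_mass_base_point by blast
  have "((\<lambda>s. K * s) \<longlongrightarrow> K * 0) (at_right 0)" by (intro tendsto_intros)
  then have lim: "((\<lambda>s. K * s) \<longlongrightarrow> 0) (at_right 0)" by simp
  have "\<forall>\<^sub>F s in at_right 0. norm (tail_mass s x - tail_mass s z) \<le> K * s"
    using eventually_at_right_real[of 0 "1::real", simplified] K by (auto elim: eventually_mono)
  from Lim_null_comparison[OF this lim] show ?thesis .
qed

lemma tail_mass_measurable[measurable]: "tail_mass s \<in> borel_measurable \<mu>"
  unfolding tail_mass_def[abs_def] by measurable

lemma tail_mass_average_limit:
  assumes U: "integrable \<mu> U" "\<And>x. 0 \<le> U x"
  shows "((\<lambda>s. (\<integral>x. U x * tail_mass s x \<partial>\<mu>) - tail_mass s z * (\<integral>x. U x \<partial>\<mu>)) \<longlongrightarrow> 0) (at_right 0)"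
proof -
  define B where "B = (\<alpha> + p) / p * C"
  have [measurable]: "U \<in> borel_measurable \<mu>" using U by auto
  have "((\<lambda>s. \<integral>x. U x * (tail_mass s x - tail_mass s z) \<partial>\<mu>) \<longlongrightarrow> (\<integral>x. 0 \<partial>\<mu>)) (at_right 0)"
  proof (rule dominated_convergence_at_right_0[where w="\<lambda>x. U x * B"])
    show "integrable \<mu> (\<lambda>x. U x * B)" using U by simp
    show "AE x in \<mu>. ((\<lambda>s. U x * (tail_mass s x - tail_mass s z)) \<longlongrightarrow> 0) (at_right 0)"
      by (intro AE_I2 tendsto_mult_right_zero tail_mass_base_point_limit)
    show "\<forall>\<^sub>F s in at_right 0. AE x in \<mu>. \<bar>U x * (tail_mass s x - tail_mass s z)\<bar> \<le> U x * B"
      using eventually_at_right_real[of 0 "1::real", simplified]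
    proof eventually_elim
      case (elim s)
      have "\<bar>tail_mass s x - tail_mass s z\<bar> \<le> B" for x
        using tail_mass_le[of s x] tail_mass_le[of s z] tail_mass_nonneg[of s x] tail_mass_nonneg[of s z] elim
        unfolding B_def[symmetric] by auto
      then show ?case using U(2) by (auto simp: abs_mult intro!: mult_left_mono)
    qed
  qed measurable
  then have "((\<lambda>s. \<integral>x. U x * (tail_mass s x - tail_mass s z) \<partial>\<mu>) \<longlongrightarrow> 0) (at_right 0)" by simp
  then show ?thesis
  proof (rule Lim_transform_eventually)
    show "\<forall>\<^sub>F s in at_right 0. (\<integral>x. U x * (tail_mass s x - tail_mass s z) \<partial>\<mu>) = (\<integral>x. U x * tail_mass s x \<partial>\<mu>) - tail_mass s z * (\<integral>x. U x \<partial>\<mu>)"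
      using eventually_at_right_real[of 0 "1::real", simplified]
    proof eventually_elim
      case (elim s)
      have "integrable \<mu> (\<lambda>x. U x * B)" using U by simp
      then have "integrable \<mu> (\<lambda>x. U x * tail_mass s x)"
      proof (rule Bochner_Integration.integrable_bound)
        have "0 \<le> tail_mass s x" "tail_mass s x \<le> B" for x
          using tail_mass_le[of s x] tail_mass_nonneg[of s x] elim by (auto simp: B_def)
        then show "AE x in \<mu>. norm (U x * tail_mass s x) \<le> norm (U x * B)"
          using U(2) order_trans[of 0 "tail_mass s _" B] by (intro AE_I2) (simp add: abs_mult mult_left_mono)
      qed measurable
      then show ?case using U by (simp add: right_diff_distrib mult.commute)
    qed
  qed
qed

text \<open>With \<open>\<lambda> = sp\<close>, \<open>tail_mass_eq\<close> expresses the tail and the Abel mean of \<open>h\<close> through each other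
  up to the factor \<open>(\<alpha> + sp) / p \<rightarrow> \<alpha> / p\<close> and a term of order \<open>s\<close>.\<close>

lemma tail_mass_tendsto_iff_mean_density:
  "((\<lambda>s. tail_mass s x) \<longlongrightarrow> \<alpha> * m / p) (at_right 0) \<longleftrightarrow> (mean_density \<mu> \<alpha> x \<longlongrightarrow> m) at_top"
proof -
  have p0: "0 < p" using p by simp
  have "(mean_density \<mu> \<alpha> x \<longlongrightarrow> m) at_top \<longleftrightarrow> (laplace_mean x \<longlongrightarrow> m) (at_right 0)"
    unfolding laplace_mean_def[abs_def] mean_density_def[abs_def]
    by (rule laplace_mean_iff_cesaro_mean[symmetric, of _ C]) (use log_density_bounds in auto)
  also have "\<dots> \<longleftrightarrow> ((\<lambda>s. laplace_mean x (s * p)) \<longlongrightarrow> m) (at_right 0)"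
  proof
    assume "(laplace_mean x \<longlongrightarrow> m) (at_right 0)"
    from filterlim_compose[OF this filterlim_times_at_right_0[OF p0]] show "((\<lambda>s. laplace_mean x (s * p)) \<longlongrightarrow> m) (at_right 0)" .
  next
    assume "((\<lambda>s. laplace_mean x (s * p)) \<longlongrightarrow> m) (at_right 0)"
    from filterlim_compose[OF this filterlim_times_at_right_0[of "1 / p"]] p0 show "(laplace_mean x \<longlongrightarrow> m) (at_right 0)" by simp
  qed
  also have "\<dots> \<longleftrightarrow> ((\<lambda>s. tail_mass s x) \<longlongrightarrow> \<alpha> * m / p) (at_right 0)"
  proof
    assume "((\<lambda>s. laplace_mean x (s * p)) \<longlongrightarrow> m) (at_right 0)"
    then have "((\<lambda>s. (\<alpha> + s * p) / p * laplace_mean x (s * p) - s * ball_volume \<mu> x 1) \<longlongrightarrow> (\<alpha> + 0 * p) / p * m - 0 * ball_volume \<mu> x 1) (at_right 0)"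
      using p0 by (intro tendsto_intros) auto
    then have "((\<lambda>s. (\<alpha> + s * p) / p * laplace_mean x (s * p) - s * ball_volume \<mu> x 1) \<longlongrightarrow> \<alpha> * m / p) (at_right 0)"
      by simp
    then show "((\<lambda>s. tail_mass s x) \<longlongrightarrow> \<alpha> * m / p) (at_right 0)"
      by (rule Lim_transform_eventually)
         (use eventually_at_right_less[of "0::real"] tail_mass_eq in \<open>auto elim!: eventually_mono\<close>)
  next
    assume "((\<lambda>s. tail_mass s x) \<longlongrightarrow> \<alpha> * m / p) (at_right 0)"
    then have "((\<lambda>s. (tail_mass s x + s * ball_volume \<mu> x 1) * (p / (\<alpha> + s * p))) \<longlongrightarrow> (\<alpha> * m / p + 0 * ball_volume \<mu> x 1) * (p / (\<alpha> + 0 * p))) (at_right 0)"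
      using \<alpha> by (intro tendsto_intros) auto
    then have "((\<lambda>s. (tail_mass s x + s * ball_volume \<mu> x 1) * (p / (\<alpha> + s * p))) \<longlongrightarrow> m) (at_right 0)"
      using \<alpha> p0 by simp
    then show "((\<lambda>s. laplace_mean x (s * p)) \<longlongrightarrow> m) (at_right 0)"
    proof (rule Lim_transform_eventually)
      show "\<forall>\<^sub>F s in at_right 0. (tail_mass s x + s * ball_volume \<mu> x 1) * (p / (\<alpha> + s * p)) = laplace_mean x (s * p)"
        using eventually_at_right_less[of "0::real"]
      proof eventually_elim
        case (elim s)
        have "0 < \<alpha> + s * p" using elim \<alpha> p0 by (simp add: add_pos_pos)
        then show ?case using p0 by (simp add: tail_mass_eq[OF elim])
      qed
    qed
  qed
  finally show ?thesis ..
qed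

section \<open>Far energy and full energy\<close>

text \<open>The substitution \<open>r = e\<^sup>t\<close>.\<close>

lemma mean_density_eq_log_average:
  assumes R: "1 < R"
  shows "1 / ln R * (LBINT r:{1..R}. ball_volume \<mu> x r / r powr \<alpha> * (1 / r)) = mean_density \<mu> \<alpha> x (ln R)"
proof -
  define f where "f r = ball_volume \<mu> x r / r powr \<alpha> * (1 / r)" for r
  have [measurable]: "ball_volume \<mu> x \<in> borel_measurable borel"
    by (intro borel_measurable_mono monoI ball_volume_mono)
  have [measurable]: "f \<in> borel_measurable borel" unfolding f_def[abs_def] by measurable
  have "integrable lborel (\<lambda>r. C * indicator {1..R} r :: real)"
    by (intro integrable_mult_right integrable_indicator_Icc)
  then have "integrable lborel (\<lambda>r. indicator {1..R} r * f r)"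
  proof (rule Bochner_Integration.integrable_bound)
    have "\<bar>f r\<bar> \<le> C" if "1 \<le> r" for r
    proof -
      have "0 \<le> ball_volume \<mu> x r / r powr \<alpha>" "ball_volume \<mu> x r / r powr \<alpha> \<le> C" "0 \<le> 1 / r" "1 / r \<le> 1"
        using ball_volume_le[OF that, of x] that by (auto simp: ball_volume_def divide_le_eq)
      then show ?thesis
        unfolding f_def using mult_mono[of "ball_volume \<mu> x r / r powr \<alpha>" C "1 / r" 1] C
        by (simp add: abs_mult ball_volume_def)
    qed
    then show "AE r in lborel. norm (indicator {1..R} r * f r) \<le> norm (C * indicator {1..R} r)"
      using C by (auto simp: indicator_def)
  qed measurable
  then have int: "set_integrable lborel {exp 0..exp (ln R)} f"
    using R by (simp add: set_integrable_def)
  have "(\<integral>r. f r * indicator {exp 0..exp (ln R)} r \<partial>lborel) = (\<integral>t. f (exp t) * exp t * indicator {0..ln R} t \<partial>lborel)"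
    by (rule integral_substitution(2)[where g=exp and g'=exp and a=0 and b="ln R", OF int]) (use R in \<open>auto intro!: derivative_eq_intros continuous_intros\<close>)
  also have "\<dots> = (\<integral>t. indicator {0..ln R} t * log_density \<mu> \<alpha> x t \<partial>lborel)"
    by (intro Bochner_Integration.integral_cong) (auto simp: f_def log_density_def powr_def exp_minus field_simps)
  finally show ?thesis
    using R by (simp add: mean_density_def set_lebesgue_integral_def f_def mult.commute)
qed

definition far_integral :: "real \<Rightarrow> ('a \<Rightarrow> real) \<Rightarrow> real" where
  "far_integral s u = (\<integral>(x, y). \<bar>u x - u y\<bar> powr p * tail_kernel s x y \<partial>(\<mu> \<Otimes>\<^sub>M \<mu>))"

lemma tail_potential_eq:
  assumes s: "0 < s"
  shows "tail_potential \<mu> \<alpha> p s x = ennreal (tail_mass s x)"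
proof -
  have "tail_potential \<mu> \<alpha> p s x = (\<integral>\<^sup>+y. ennreal s * (ennreal (dist x y powr (- \<alpha> - s * p)) * indicator {y. 1 < dist x y} y) \<partial>\<mu>)"
    unfolding tail_potential_def by (rule nn_integral_cmult[symmetric]) measurable
  also have "\<dots> = (\<integral>\<^sup>+y. ennreal (tail_kernel s x y) \<partial>\<mu>)"
    using s by (intro nn_integral_cong) (auto simp: tail_kernel_def ennreal_mult indicator_def)
  finally show ?thesis using nn_integral_tail[OF s] by simp
qed

lemma gagliardo_kernel_measurable[measurable]:
  assumes [measurable]: "u \<in> borel_measurable \<mu>"
  shows "gagliardo_kernel \<alpha> p s u \<in> borel_measurable (\<mu> \<Otimes>\<^sub>M \<mu>)"
  unfolding gagliardo_kernel_def split_beta' by measurable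

lemma dist_sets_measurable[measurable]:
  "{(x, y). 1 < dist x y} \<in> sets (\<mu> \<Otimes>\<^sub>M \<mu>)"
  "{(x, y). x \<noteq> y \<and> dist x y \<le> 1} \<in> sets (\<mu> \<Otimes>\<^sub>M \<mu>)"
proof -
  have space: "space (\<mu> \<Otimes>\<^sub>M \<mu>) = UNIV" by (simp add: space_pair_measure)
  have "{z \<in> space (\<mu> \<Otimes>\<^sub>M \<mu>). 1 < dist (fst z) (snd z)} \<in> sets (\<mu> \<Otimes>\<^sub>M \<mu>)"
    "{z \<in> space (\<mu> \<Otimes>\<^sub>M \<mu>). dist (fst z) (snd z) \<noteq> 0 \<and> dist (fst z) (snd z) \<le> 1} \<in> sets (\<mu> \<Otimes>\<^sub>M \<mu>)"
    by measurable
  then show "{(x, y). 1 < dist x y} \<in> sets (\<mu> \<Otimes>\<^sub>M \<mu>)"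
    "{(x, y). x \<noteq> y \<and> dist x y \<le> 1} \<in> sets (\<mu> \<Otimes>\<^sub>M \<mu>)"
    by (simp_all add: space split_beta')
qed

lemma Lp_spaceD:
  assumes "u \<in> Lp_space \<mu> p"
  shows "u \<in> borel_measurable \<mu>" "integrable \<mu> (\<lambda>x. \<bar>u x\<bar> powr p)"
  using assms by (auto simp: Lp_space_def)

lemma far_energy_eq:
  assumes u: "u \<in> Lp_space \<mu> p" and s: "0 < s" "s < 1"
  shows "far_energy \<mu> \<alpha> p s u = ennreal (far_integral s u)" and "0 \<le> far_integral s u"
proof -
  note [measurable] = Lp_spaceD(1)[OF u]
  let ?f = "\<lambda>(x, y). \<bar>u x - u y\<bar> powr p * tail_kernel s x y"
  have p0: "0 < p" using p by simp
  have nonneg: "AE z in \<mu> \<Otimes>\<^sub>M \<mu>. 0 \<le> ?f z"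
    using tail_kernel_nonneg[OF s(1)] by (intro AE_I2) (auto simp: split_beta')
  have int: "integrable (\<mu> \<Otimes>\<^sub>M \<mu>) ?f"
    using symmetric_kernel_energy_integrable[OF sigma_finite_measure_axioms tail_kernel_measurable
        tail_kernel_nonneg tail_kernel_le tail_kernel_sym nn_integral_tail_kernel_le _ Lp_spaceD[OF u] p0 s]
      \<alpha> p C by simp
  have "far_energy \<mu> \<alpha> p s u = (\<integral>\<^sup>+z. ennreal s * (gagliardo_kernel \<alpha> p s u z * indicator {(x, y). 1 < dist x y} z) \<partial>(\<mu> \<Otimes>\<^sub>M \<mu>))"
    unfolding far_energy_def by (rule nn_integral_cmult[symmetric]) measurable
  also have "\<dots> = (\<integral>\<^sup>+z. ennreal (?f z) \<partial>(\<mu> \<Otimes>\<^sub>M \<mu>))"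
  proof (intro nn_integral_cong)
    fix z :: "'a \<times> 'a"
    obtain x y where z: "z = (x, y)" by (cases z)
    show "ennreal s * (gagliardo_kernel \<alpha> p s u z * indicator {(x, y). 1 < dist x y} z) = ennreal (?f z)"
    proof (cases "1 < dist x y")
      case True
      have "dist x y powr (- \<alpha> - s * p) = 1 / dist x y powr (\<alpha> + s * p)"
        using powr_minus_divide[of "dist x y" "\<alpha> + s * p"] by simp
      then show ?thesis
        using True s by (simp add: z gagliardo_kernel_def tail_kernel_def mult.commute flip: ennreal_mult)
    qed (simp add: z tail_kernel_def)
  qed
  also have "\<dots> = ennreal (far_integral s u)"
    unfolding far_integral_def using nn_integral_eq_integral[OF int nonneg] .
  finally show "far_energy \<mu> \<alpha> p s u = ennreal (far_integral s u)" .
  show "0 \<le> far_integral s u" unfolding far_integral_def using nonneg by (rule integral_nonneg_AE)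
qed

lemma far_integral_limit:
  assumes u: "u \<in> Lp_space \<mu> p"
  shows "((\<lambda>s. far_integral s u - 2 * tail_mass s z * (\<integral>x. \<bar>u x\<bar> powr p \<partial>\<mu>)) \<longlongrightarrow> 0) (at_right 0)"
proof -
  have p0: "0 < p" using p by simp
  have "((\<lambda>s. far_integral s u - 2 * (\<integral>x. \<bar>u x\<bar> powr p * tail_mass s x \<partial>\<mu>)) \<longlongrightarrow> 0) (at_right 0)"
    unfolding far_integral_def tail_mass_def
    using symmetric_kernel_energy_decouples[OF sigma_finite_measure_axioms tail_kernel_measurable
        tail_kernel_nonneg tail_kernel_le tail_kernel_sym nn_integral_tail_kernel_le _ Lp_spaceD[OF u] p0]
      \<alpha> p C by simp
  moreover have "((\<lambda>s. 2 * ((\<integral>x. \<bar>u x\<bar> powr p * tail_mass s x \<partial>\<mu>) - tail_mass s z * (\<integral>x. \<bar>u x\<bar> powr p \<partial>\<mu>))) \<longlongrightarrow> 2 * 0) (at_right 0)"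
    by (intro tendsto_mult_left tail_mass_average_limit Lp_spaceD[OF u]) auto
  ultimately have "((\<lambda>s. (far_integral s u - 2 * (\<integral>x. \<bar>u x\<bar> powr p * tail_mass s x \<partial>\<mu>))
     + 2 * ((\<integral>x. \<bar>u x\<bar> powr p * tail_mass s x \<partial>\<mu>) - tail_mass s z * (\<integral>x. \<bar>u x\<bar> powr p \<partial>\<mu>))) \<longlongrightarrow> 0 + 2 * 0) (at_right 0)"
    by (rule tendsto_add)
  then show ?thesis by (simp add: algebra_simps)
qed

text \<open>For \<open>d(x, y) \<le> 1\<close> the kernel increases with \<open>s\<close>, so the contribution of these pairs is at most
  \<open>s\<close> times its finite value at \<open>s\<^sub>0\<close>. It is stated with a real remainder \<open>n\<close> so that the finiteness
  of the energy for \<open>s < s\<^sub>0\<close> is part of the conclusion.\<close>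

lemma energy_near_diagonal:
  assumes u: "u \<in> Lp_space \<mu> p" and s0: "s0 < 1" "gagliardo_pow \<mu> \<alpha> p s0 u < \<infinity>"
  shows "\<exists>G. \<forall>s. 0 < s \<longrightarrow> s < s0 \<longrightarrow> (\<exists>n. 0 \<le> n \<and> n \<le> G * s \<and> energy \<mu> \<alpha> p s u = ennreal (far_integral s u + n))"
proof -
  note [measurable] = Lp_spaceD(1)[OF u]
  define near where "near s = (\<integral>\<^sup>+z\<in>{(x, y). x \<noteq> y \<and> dist x y \<le> 1}. gagliardo_kernel \<alpha> p s u z \<partial>(\<mu> \<Otimes>\<^sub>M \<mu>))" for s
  have "near s0 \<le> gagliardo_pow \<mu> \<alpha> p s0 u"
    unfolding near_def gagliardo_pow_def by (intro nn_integral_mono) (auto simp: indicator_def)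
  then have fin: "near s0 < \<infinity>" using s0(2) by (rule order_le_less_trans)
  define G where "G = enn2real (near s0)"
  have G: "near s0 = ennreal G" using fin by (simp add: G_def)
  have near_mono: "near s \<le> near s0" if s: "0 < s" "s < s0" for s
    unfolding near_def
  proof (intro nn_integral_mono)
    fix z :: "'a \<times> 'a"
    obtain x y where z: "z = (x, y)" by (cases z)
    have "gagliardo_kernel \<alpha> p s u z \<le> gagliardo_kernel \<alpha> p s0 u z" if d: "x \<noteq> y" "dist x y \<le> 1"
      unfolding z gagliardo_kernel_def prod.case
    proof (intro ennreal_leI divide_left_mono)
      show "dist x y powr (\<alpha> + s0 * p) \<le> dist x y powr (\<alpha> + s * p)"
        using s d p by (intro powr_mono') auto
    qed (use d in auto)
    then show "gagliardo_kernel \<alpha> p s u z * indicator {(x, y). x \<noteq> y \<and> dist x y \<le> 1} z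
      \<le> gagliardo_kernel \<alpha> p s0 u z * indicator {(x, y). x \<noteq> y \<and> dist x y \<le> 1} z"
      by (auto simp: z indicator_def)
  qed
  have "\<exists>n. 0 \<le> n \<and> n \<le> G * s \<and> energy \<mu> \<alpha> p s u = ennreal (far_integral s u + n)" if s: "0 < s" "s < s0" for s
  proof -
    have s1: "s < 1" using s s0 by simp
    have "gagliardo_pow \<mu> \<alpha> p s u = (\<integral>\<^sup>+z. gagliardo_kernel \<alpha> p s u z * indicator {(x, y). 1 < dist x y} z
        + gagliardo_kernel \<alpha> p s u z * indicator {(x, y). x \<noteq> y \<and> dist x y \<le> 1} z \<partial>(\<mu> \<Otimes>\<^sub>M \<mu>))"
      unfolding gagliardo_pow_def by (intro nn_integral_cong) (auto simp: indicator_def)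
    also have "\<dots> = (\<integral>\<^sup>+z\<in>{(x, y). 1 < dist x y}. gagliardo_kernel \<alpha> p s u z \<partial>(\<mu> \<Otimes>\<^sub>M \<mu>)) + near s"
      unfolding near_def by (rule nn_integral_add) measurable
    finally have "energy \<mu> \<alpha> p s u = far_energy \<mu> \<alpha> p s u + ennreal s * near s"
      unfolding energy_def far_energy_def by (simp add: distrib_left)
    moreover obtain r where r: "near s = ennreal r" "0 \<le> r" "r \<le> G"
      using near_mono[OF s] unfolding G by (auto simp: le_ennreal_iff G_def)
    ultimately have "energy \<mu> \<alpha> p s u = ennreal (far_integral s u + s * r)"
      using far_energy_eq[OF u s(1) s1] s by (simp add: ennreal_mult)
    then show ?thesis
      using s r by (intro exI[of _ "s * r"]) (auto simp: mult.commute mult_left_mono)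
  qed
  then show ?thesis by blast
qed

lemma energy_domain_Lp: "u \<in> energy_domain \<mu> \<alpha> p \<Longrightarrow> u \<in> Lp_space \<mu> p"
  by (auto simp: energy_domain_def)

text \<open>The energy may be infinite for large \<open>s\<close>, where \<open>enn2real\<close> returns \<open>0\<close>; the second
  conclusion guarantees that this does not happen near \<open>s = 0\<close>.\<close>

lemma energy_limit:
  assumes u: "u \<in> energy_domain \<mu> \<alpha> p"
  shows "((\<lambda>s. enn2real (energy \<mu> \<alpha> p s u) - 2 * tail_mass s z * (\<integral>x. \<bar>u x\<bar> powr p \<partial>\<mu>)) \<longlongrightarrow> 0) (at_right 0)"
    and "\<forall>\<^sub>F s in at_right 0. energy \<mu> \<alpha> p s u = ennreal (enn2real (energy \<mu> \<alpha> p s u))"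
proof -
  note uL = energy_domain_Lp[OF u]
  obtain s0 where s0: "0 < s0" "s0 < 1" "gagliardo_pow \<mu> \<alpha> p s0 u < \<infinity>"
    using u by (auto simp: energy_domain_def)
  obtain G where G: "\<And>s. 0 < s \<Longrightarrow> s < s0 \<Longrightarrow> \<exists>n. 0 \<le> n \<and> n \<le> G * s \<and> energy \<mu> \<alpha> p s u = ennreal (far_integral s u + n)"
    using energy_near_diagonal[OF uL s0(2,3)] by blast
  have ev: "\<forall>\<^sub>F s in at_right 0. s \<in> {0<..<s0}" using eventually_at_right_real[OF s0(1)] .
  show "\<forall>\<^sub>F s in at_right 0. energy \<mu> \<alpha> p s u = ennreal (enn2real (energy \<mu> \<alpha> p s u))"
    using ev
  proof eventually_elim
    case (elim s)
    then obtain n where "energy \<mu> \<alpha> p s u = ennreal (far_integral s u + n)" using G[of s] by auto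
    then show ?case by simp
  qed
  have "((\<lambda>s. G * s) \<longlongrightarrow> G * 0) (at_right 0)" by (intro tendsto_intros)
  then have lim: "((\<lambda>s. G * s) \<longlongrightarrow> 0) (at_right 0)" by simp
  have "\<forall>\<^sub>F s in at_right 0. norm (enn2real (energy \<mu> \<alpha> p s u) - far_integral s u) \<le> G * s"
    using ev
  proof eventually_elim
    case (elim s)
    then obtain n where n: "0 \<le> n" "n \<le> G * s" "energy \<mu> \<alpha> p s u = ennreal (far_integral s u + n)" using G[of s] by auto
    have "0 \<le> far_integral s u" using far_energy_eq(2)[OF uL, of s] elim s0 by simp
    then have "enn2real (energy \<mu> \<alpha> p s u) = far_integral s u + n"
      using n by (simp del: ennreal_plus)
    then show ?case using n by simp
  qed
  from Lim_null_comparison[OF this lim]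
  have "((\<lambda>s. enn2real (energy \<mu> \<alpha> p s u) - far_integral s u) \<longlongrightarrow> 0) (at_right 0)" .
  from tendsto_add[OF this far_integral_limit[OF uL, of z]]
  show "((\<lambda>s. enn2real (energy \<mu> \<alpha> p s u) - 2 * tail_mass s z * (\<integral>x. \<bar>u x\<bar> powr p \<partial>\<mu>)) \<longlongrightarrow> 0) (at_right 0)"
    by simp
qed

lemma energy_tendsto_iff:
  assumes u: "u \<in> energy_domain \<mu> \<alpha> p"
  shows "((\<lambda>s. enn2ereal (energy \<mu> \<alpha> p s u)) \<longlongrightarrow> ereal L) (at_right 0)
    \<longleftrightarrow> ((\<lambda>s. 2 * tail_mass s z * (\<integral>x. \<bar>u x\<bar> powr p \<partial>\<mu>)) \<longlongrightarrow> L) (at_right 0)"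
proof -
  have "\<forall>\<^sub>F s in at_right 0. enn2ereal (energy \<mu> \<alpha> p s u) = ereal (enn2real (energy \<mu> \<alpha> p s u))"
    using energy_limit(2)[OF u] by eventually_elim (metis enn2ereal_ennreal enn2real_nonneg)
  then have "((\<lambda>s. enn2ereal (energy \<mu> \<alpha> p s u)) \<longlongrightarrow> ereal L) (at_right 0)
     \<longleftrightarrow> ((\<lambda>s. ereal (enn2real (energy \<mu> \<alpha> p s u))) \<longlongrightarrow> ereal L) (at_right 0)"
    by (intro filterlim_cong refl)
  also have "\<dots> \<longleftrightarrow> ((\<lambda>s. enn2real (energy \<mu> \<alpha> p s u)) \<longlongrightarrow> L) (at_right 0)"
    by (rule lim_ereal)
  also have "\<dots> \<longleftrightarrow> ((\<lambda>s. 2 * tail_mass s z * (\<integral>x. \<bar>u x\<bar> powr p \<partial>\<mu>)) \<longlongrightarrow> L) (at_right 0)"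
    using Lim_transform[OF _ energy_limit(1)[OF u, of z], of L]
      Lim_transform2[OF _ energy_limit(1)[OF u, of z], of L] by blast
  finally show ?thesis .
qed

lemma tail_potential_tendsto_iff:
  "((\<lambda>s. enn2ereal (tail_potential \<mu> \<alpha> p s z)) \<longlongrightarrow> ereal L) (at_right 0)
    \<longleftrightarrow> ((\<lambda>s. tail_mass s z) \<longlongrightarrow> L) (at_right 0)"
proof -
  have "\<forall>\<^sub>F s in at_right 0. enn2ereal (tail_potential \<mu> \<alpha> p s z) = ereal (tail_mass s z)"
    using eventually_at_right_less[of "0::real"]
    by eventually_elim (simp add: tail_potential_eq tail_mass_nonneg)
  then have "((\<lambda>s. enn2ereal (tail_potential \<mu> \<alpha> p s z)) \<longlongrightarrow> ereal L) (at_right 0)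
     \<longleftrightarrow> ((\<lambda>s. ereal (tail_mass s z)) \<longlongrightarrow> ereal L) (at_right 0)"
    by (intro filterlim_cong refl)
  then show ?thesis by (simp only: lim_ereal)
qed

text \<open>Transfers a limit between real-valued functions to the extended real difference, which near zero
  has finite terms only.\<close>

lemma ereal_difference_limit:
  assumes lim: "((\<lambda>s. f s - 2 * tail_mass s z * N) \<longlongrightarrow> 0) (at_right 0)"
    and g: "\<forall>\<^sub>F s in at_right 0. g s = ennreal (f s) \<and> 0 \<le> f s" and N: "0 \<le> N"
  shows "((\<lambda>s. enn2ereal (g s) - enn2ereal (2 * tail_potential \<mu> \<alpha> p s z * ennreal N)) \<longlongrightarrow> 0) (at_right 0)"
proof -
  have "((\<lambda>s. ereal (f s - 2 * tail_mass s z * N)) \<longlongrightarrow> ereal 0) (at_right 0)"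
    using lim by (simp only: lim_ereal)
  then have "((\<lambda>s. ereal (f s - 2 * tail_mass s z * N)) \<longlongrightarrow> 0) (at_right 0)" by (simp only: zero_ereal_def)
  then show ?thesis
  proof (rule Lim_transform_eventually)
    show "\<forall>\<^sub>F s in at_right 0. ereal (f s - 2 * tail_mass s z * N) = enn2ereal (g s) - enn2ereal (2 * tail_potential \<mu> \<alpha> p s z * ennreal N)"
      using g eventually_at_right_less[of "0::real"]
    proof eventually_elim
      case (elim s)
      have "2 * tail_potential \<mu> \<alpha> p s z * ennreal N = ennreal (2 * tail_mass s z * N)"
        using elim N tail_mass_nonneg[of s z] by (simp add: tail_potential_eq ennreal_mult)
      then show ?case using elim N tail_mass_nonneg[of s z] by simp
    qed
  qed
qed

end

section \<open>Asymptotics of the energy\<close>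

lemma Lp_norm_powr:
  "0 < p \<Longrightarrow> Lp_norm M p u powr p = (\<integral>x. \<bar>u x\<bar> powr p \<partial>M)"
  by (simp add: Lp_norm_def powr_powr integral_nonneg_AE)

theorem theorem1p1:
  fixes \<mu> :: "'a::polish_space measure" and \<alpha> C p :: real and x0 :: 'a
  assumes unbounded: "\<not> bounded (UNIV :: 'a set)"
    and borel: "sets \<mu> = sets borel"
    and "\<alpha> > 0" and "C > 0"
    and volume: "\<And>x r. r \<ge> 1 \<Longrightarrow>
      0 < emeasure \<mu> (cball x r) \<and> emeasure \<mu> (cball x r) \<le> ennreal (C * r powr \<alpha>)"
    and "1 \<le> p"
  shows
    "(\<forall>u\<in>Lp_space \<mu> p.
        ((\<lambda>s. enn2ereal (far_energy \<mu> \<alpha> p s u)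
            - enn2ereal (2 * tail_potential \<mu> \<alpha> p s x0 * ennreal (Lp_norm \<mu> p u powr p)))
          \<longlongrightarrow> 0) (at_right 0))
   \<and> (\<forall>u\<in>energy_domain \<mu> \<alpha> p.
        ((\<lambda>s. enn2ereal (energy \<mu> \<alpha> p s u)
            - enn2ereal (2 * tail_potential \<mu> \<alpha> p s x0 * ennreal (Lp_norm \<mu> p u powr p)))
          \<longlongrightarrow> 0) (at_right 0))
   \<and> (\<forall>u\<in>energy_domain \<mu> \<alpha> p. Lp_norm \<mu> p u > 0 \<longrightarrow>
        ((\<exists>L::real. ((\<lambda>s. enn2ereal (energy \<mu> \<alpha> p s u)) \<longlongrightarrow> ereal L) (at_right 0))
          \<longleftrightarrow> (\<exists>L::real. ((\<lambda>s. enn2ereal (tail_potential \<mu> \<alpha> p s x0)) \<longlongrightarrow> ereal L) (at_right 0)))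
      \<and> ((\<exists>L::real. ((\<lambda>s. enn2ereal (tail_potential \<mu> \<alpha> p s x0)) \<longlongrightarrow> ereal L) (at_right 0))
          \<longleftrightarrow> (\<exists>m. (mean_density \<mu> \<alpha> x0 \<longlongrightarrow> m) at_top)))
   \<and> (\<forall>m. (mean_density \<mu> \<alpha> x0 \<longlongrightarrow> m) at_top \<longrightarrow>
        (\<forall>x. (mean_density \<mu> \<alpha> x \<longlongrightarrow> m) at_top
           \<and> ((\<lambda>R. 1 / ln R * (LBINT r:{1..R}. ball_volume \<mu> x r / r powr \<alpha> * (1 / r)))
                \<longlongrightarrow> m) at_top)
      \<and> (\<forall>v\<in>energy_domain \<mu> \<alpha> p.
           ((\<lambda>s. enn2ereal (energy \<mu> \<alpha> p s v))
             \<longlongrightarrow> ereal (2 * \<alpha> / p * m * Lp_norm \<mu> p v powr p)) (at_right 0)))"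
proof -
  interpret volume_growth \<mu> \<alpha> C p
    using assms by unfold_locales auto
  have p0: "0 < p" using p by simp
  have N: "Lp_norm \<mu> p u powr p = (\<integral>x. \<bar>u x\<bar> powr p \<partial>\<mu>)" for u
    using p0 by (rule Lp_norm_powr)
  have Nnn: "0 \<le> (\<integral>x. \<bar>u x\<bar> powr p \<partial>\<mu>)" for u by (simp add: integral_nonneg_AE)
  have part1: "((\<lambda>s. enn2ereal (far_energy \<mu> \<alpha> p s u)
            - enn2ereal (2 * tail_potential \<mu> \<alpha> p s x0 * ennreal (Lp_norm \<mu> p u powr p)))
          \<longlongrightarrow> 0) (at_right 0)" if u: "u \<in> Lp_space \<mu> p" for u
    unfolding N
  proof (rule ereal_difference_limit[OF far_integral_limit[OF u] _ Nnn])
    show "\<forall>\<^sub>F s in at_right 0. far_energy \<mu> \<alpha> p s u = ennreal (far_integral s u) \<and> 0 \<le> far_integral s u"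
      using eventually_at_right_real[of 0 "1::real", simplified]
      by eventually_elim (use far_energy_eq[OF u] in auto)
  qed
  have part2: "((\<lambda>s. enn2ereal (energy \<mu> \<alpha> p s u)
            - enn2ereal (2 * tail_potential \<mu> \<alpha> p s x0 * ennreal (Lp_norm \<mu> p u powr p)))
          \<longlongrightarrow> 0) (at_right 0)" if u: "u \<in> energy_domain \<mu> \<alpha> p" for u
    unfolding N
    by (rule ereal_difference_limit[OF energy_limit(1)[OF u] _ Nnn])
       (use energy_limit(2)[OF u] in \<open>auto elim: eventually_mono\<close>)
  have tail_iff: "(\<exists>L::real. ((\<lambda>s. enn2ereal (tail_potential \<mu> \<alpha> p s x0)) \<longlongrightarrow> ereal L) (at_right 0))
          \<longleftrightarrow> (\<exists>m. (mean_density \<mu> \<alpha> x0 \<longlongrightarrow> m) at_top)"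
  proof -
    have "(\<exists>L. ((\<lambda>s. tail_mass s x0) \<longlongrightarrow> L) (at_right 0)) \<longleftrightarrow> (\<exists>m. ((\<lambda>s. tail_mass s x0) \<longlongrightarrow> \<alpha> * m / p) (at_right 0))"
    proof
      assume "\<exists>L. ((\<lambda>s. tail_mass s x0) \<longlongrightarrow> L) (at_right 0)"
      then obtain L where "((\<lambda>s. tail_mass s x0) \<longlongrightarrow> L) (at_right 0)" ..
      moreover have "L = \<alpha> * (p * L / \<alpha>) / p" using \<alpha> p0 by simp
      ultimately show "\<exists>m. ((\<lambda>s. tail_mass s x0) \<longlongrightarrow> \<alpha> * m / p) (at_right 0)" by metis
    qed blast
    then show ?thesis
      by (simp only: tail_potential_tendsto_iff tail_mass_tendsto_iff_mean_density)
  qed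
  have energy_iff: "(\<exists>L::real. ((\<lambda>s. enn2ereal (energy \<mu> \<alpha> p s u)) \<longlongrightarrow> ereal L) (at_right 0))
          \<longleftrightarrow> (\<exists>L::real. ((\<lambda>s. enn2ereal (tail_potential \<mu> \<alpha> p s x0)) \<longlongrightarrow> ereal L) (at_right 0))"
    if u: "u \<in> energy_domain \<mu> \<alpha> p" and pos: "0 < Lp_norm \<mu> p u" for u
  proof -
    define n where "n = (\<integral>x. \<bar>u x\<bar> powr p \<partial>\<mu>)"
    have n: "0 < n" using pos N[of u] by (simp add: n_def flip: N)
    have "(\<exists>L. ((\<lambda>s. 2 * tail_mass s x0 * n) \<longlongrightarrow> L) (at_right 0)) \<longleftrightarrow> (\<exists>L. ((\<lambda>s. tail_mass s x0) \<longlongrightarrow> L) (at_right 0))"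
    proof
      assume "\<exists>L. ((\<lambda>s. 2 * tail_mass s x0 * n) \<longlongrightarrow> L) (at_right 0)"
      then obtain L where "((\<lambda>s. 2 * tail_mass s x0 * n) \<longlongrightarrow> L) (at_right 0)" ..
      from tendsto_mult_right[OF this, of "1 / (2 * n)"] n
      show "\<exists>L. ((\<lambda>s. tail_mass s x0) \<longlongrightarrow> L) (at_right 0)" by (auto simp: mult.commute)
    next
      assume "\<exists>L. ((\<lambda>s. tail_mass s x0) \<longlongrightarrow> L) (at_right 0)"
      then obtain L where "((\<lambda>s. tail_mass s x0) \<longlongrightarrow> L) (at_right 0)" ..
      then have "((\<lambda>s. 2 * tail_mass s x0 * n) \<longlongrightarrow> 2 * L * n) (at_right 0)"
        by (intro tendsto_intros)
      then show "\<exists>L. ((\<lambda>s. 2 * tail_mass s x0 * n) \<longlongrightarrow> L) (at_right 0)" ..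
    qed
    then show ?thesis
      by (simp only: energy_tendsto_iff[OF u, of _ x0] tail_potential_tendsto_iff n_def)
  qed
  have base: "(mean_density \<mu> \<alpha> x \<longlongrightarrow> m) at_top"
    if m: "(mean_density \<mu> \<alpha> x0 \<longlongrightarrow> m) at_top" for m x
  proof -
    have "((\<lambda>s. tail_mass s x0) \<longlongrightarrow> \<alpha> * m / p) (at_right 0)"
      using m by (simp only: tail_mass_tendsto_iff_mean_density)
    from Lim_transform[OF this tail_mass_base_point_limit[of x x0]]
    show ?thesis by (simp only: tail_mass_tendsto_iff_mean_density)
  qed
  have log_average: "((\<lambda>R. 1 / ln R * (LBINT r:{1..R}. ball_volume \<mu> x r / r powr \<alpha> * (1 / r))) \<longlongrightarrow> m) at_top"
    if m: "(mean_density \<mu> \<alpha> x \<longlongrightarrow> m) at_top" for m x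
    using filterlim_compose[OF m ln_at_top]
    by (rule Lim_transform_eventually)
       (intro eventually_mono[OF eventually_gt_at_top[of "1::real"]] mean_density_eq_log_average[symmetric])
  have energy_value: "((\<lambda>s. enn2ereal (energy \<mu> \<alpha> p s v)) \<longlongrightarrow> ereal (2 * \<alpha> / p * m * Lp_norm \<mu> p v powr p)) (at_right 0)"
    if m: "(mean_density \<mu> \<alpha> x0 \<longlongrightarrow> m) at_top" and v: "v \<in> energy_domain \<mu> \<alpha> p" for m v
  proof -
    have "((\<lambda>s. tail_mass s x0) \<longlongrightarrow> \<alpha> * m / p) (at_right 0)"
      using m by (simp only: tail_mass_tendsto_iff_mean_density)
    then have "((\<lambda>s. 2 * tail_mass s x0 * (\<integral>x. \<bar>v x\<bar> powr p \<partial>\<mu>)) \<longlongrightarrow> 2 * (\<alpha> * m / p) * (\<integral>x. \<bar>v x\<bar> powr p \<partial>\<mu>)) (at_right 0)"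
      by (intro tendsto_intros)
    then show ?thesis
      unfolding N energy_tendsto_iff[OF v, of _ x0] by (simp add: mult.assoc)
  qed
  show ?thesis
    using part1 part2 tail_iff energy_iff base log_average energy_value by blast
qed

end
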